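(* Let $\epsilon>0$ be a fixed constant, let $\delta>0$, and let $p=p(n)$ satisfy $n^{-1/3+\delta}\le p\le 1/2$. Let $b=1/(1-p)$. Then asymptotically almost surely the random graph $G_{n,p}$ has the following property: for every graph $H$ on the same vertex set $\{1,\dots,n\}$ with maximum degree $\Delta(H)\le 2^{-8}\epsilon\frac{n}{\log_b(np)\,\log\log n}$, the chromatic number of $G_{n,p}\cup H$ is at most $(1+\epsilon)\frac{n}{2\log_b(np)}$.
   Context: $G_{n,p}$ is the random graph on the vertex set $\{1,\dots,n\}$ in which each pair of vertices is an edge independently with probability $p$. $G_{n,p}\cup H$ denotes the graph on $\{1,\dots,n\}$ whose edge set is the union of the edge sets of $G_{n,p}$ and $H$. "Asymptotically almost surely" means with probability tending to $1$ as $n\to\infty$. $\log$ is the natural logarithm and $\log_b x=\log x/\log b$. *)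

theory Defs
  imports "HOL-Probability.Probability" "HOL-Library.Ramsey"
begin

text \<open>
  A finite simple graph on the vertex set \<open>V\<close> is represented by its edge set, a set of
  two-element subsets of \<open>V\<close>; \<open>nsets V 2\<close> is the set of all pairs of vertices.
\<close>

definition simple_graph :: "'a set \<Rightarrow> 'a set set \<Rightarrow> bool" where
  "simple_graph V E \<longleftrightarrow> E \<subseteq> nsets V 2"

definition vertex_degree :: "'a set set \<Rightarrow> 'a \<Rightarrow> nat" where
  "vertex_degree E v = card {e \<in> E. v \<in> e}"

text \<open>Only meaningful for finite nonempty \<open>V\<close>.\<close>
definition max_degree :: "'a set \<Rightarrow> 'a set set \<Rightarrow> nat" where
  "max_degree V E = Max (vertex_degree E ` V)"

definition proper_colouring :: "'a set \<Rightarrow> 'a set set \<Rightarrow> nat \<Rightarrow> ('a \<Rightarrow> nat) \<Rightarrow> bool" where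
  "proper_colouring V E k c \<longleftrightarrow>
     c ` V \<subseteq> {..<k} \<and> (\<forall>u\<in>V. \<forall>v\<in>V. {u, v} \<in> E \<longrightarrow> c u \<noteq> c v)"

definition chromatic_number :: "'a set \<Rightarrow> 'a set set \<Rightarrow> nat" where
  "chromatic_number V E = (LEAST k. \<exists>c. proper_colouring V E k c)"

text \<open>
  The distribution of the edge set of \<open>G\<^bsub>n,p\<^esub>\<close>: one independent Bernoulli trial for each
  pair of vertices.  As \<open>bernoulli_pmf\<close> clamps its parameter, this is the intended
  distribution exactly when \<open>0 \<le> p \<le> 1\<close>.
\<close>
definition Gnp :: "nat \<Rightarrow> real \<Rightarrow> nat set set pmf" where
  "Gnp n p = map_pmf (\<lambda>f. {e \<in> nsets {1..n} 2. f e})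
     (Pi_pmf (nsets {1..n} 2) False (\<lambda>_. bernoulli_pmf p))"

end

theory Submission
  imports Defs "HOL-Real_Asymp.Real_Asymp"
begin

text \<open>
  Fix \<open>k\<close> slightly smaller than \<open>2 log\<^sub>b (np)\<close>. For a vertex set \<open>U\<close> of size \<open>m\<close> let \<open>\<tau>(G)\<close> be the least
  total weight of a fractional set of pairs of \<open>U\<close> that puts weight at least 1 inside every independent
  \<open>k\<close>-subset of \<open>U\<close>. By weak duality and the second moment method \<open>\<tau>\<close> has mean of order \<open>m\<^sup>2 / k\<^sup>2\<close>, and since
  switching one edge changes \<open>\<tau>\<close> by at most 1, it fails to have this order with probability at most
  \<open>exp (- 2n)\<close> as long as \<open>m \<ge> n / (log n)\<^sup>2\<close>. Hence almost surely \<open>\<tau>\<close> is large for all such \<open>U\<close> at once.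

  This event does not mention \<open>H\<close>. Given \<open>H\<close> of maximum degree \<open>\<Delta>\<close>, the rescaled edge set of \<open>H\<close> cannot be a
  cheap fractional cover, so \<open>U\<close> contains an independent \<open>k\<close>-set of \<open>G\<close> with \<open>O(\<Delta>k\<^sup>2 / m)\<close> edges of \<open>H\<close>, and by
  Turan's theorem a set independent in both graphs of size at least \<open>1 / (1 / k + 8\<Delta> / m)\<close>. Removing such
  sets one after the other until \<open>n / (log n)\<^sup>2\<close> vertices are left costs at most
  \<open>n / k + 8\<Delta> log ((log n)\<^sup>2)\<close> colours, which is where the factor \<open>log log n\<close> comes from. The remaining
  vertices span a graph of small degeneracy.
\<close>

section \<open>Functions of a binomial random subset\<close>

text \<open>The expectation of \<open>F\<close> on a random subset of \<open>E\<close> that contains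
  each element independently with probability \<open>p\<close>. Written as a finite sum, it allows
  product formulas to be proved by induction on \<open>E\<close>.\<close>

definition subset_mean :: "'a set \<Rightarrow> real \<Rightarrow> ('a set \<Rightarrow> real) \<Rightarrow> real" where
  "subset_mean E p F = (\<Sum>A\<in>Pow E. p ^ card A * (1 - p) ^ card (E - A) * F A)"

lemma subset_mean_empty [simp]: "subset_mean {} p F = F {}"
  by (simp add: subset_mean_def)

lemma subset_mean_cong:
  "(\<And>A. A \<subseteq> E \<Longrightarrow> F A = F' A) \<Longrightarrow> subset_mean E p F = subset_mean E p F'"
  unfolding subset_mean_def by (intro sum.cong) auto

text \<open>Conditioning on whether \<open>x\<close> is chosen; this recursion drives the inductions
  on \<open>E\<close> below.\<close>

lemma subset_mean_insert:
  assumes "finite E" "x \<notin> E"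
  shows "subset_mean (insert x E) p F =
    p * subset_mean E p (\<lambda>A. F (insert x A)) + (1 - p) * subset_mean E p F"
proof -
  have disj: "Pow E \<inter> insert x ` Pow E = {}"
    using assms by auto
  have inj: "inj_on (insert x) (Pow E)"
    using assms by (auto simp: inj_on_def)
  have 1: "p ^ card A * (1 - p) ^ card (insert x E - A) * F A =
      (1 - p) * (p ^ card A * (1 - p) ^ card (E - A) * F A)" if "A \<in> Pow E" for A
  proof -
    have "insert x E - A = insert x (E - A)" using that assms by auto
    then show ?thesis using assms by simp
  qed
  have 2: "p ^ card (insert x A) * (1 - p) ^ card (insert x E - insert x A) * F (insert x A) =
      p * (p ^ card A * (1 - p) ^ card (E - A) * F (insert x A))" if "A \<in> Pow E" for A
  proof -
    have "insert x E - insert x A = E - A" using that assms by auto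
    moreover have "x \<notin> A" "finite A" using that assms finite_subset by auto
    ultimately show ?thesis by simp
  qed
  have "subset_mean (insert x E) p F =
      (\<Sum>A\<in>Pow E. p ^ card A * (1 - p) ^ card (insert x E - A) * F A) +
      (\<Sum>A\<in>Pow E. p ^ card (insert x A) * (1 - p) ^ card (insert x E - insert x A) * F (insert x A))"
    unfolding subset_mean_def Pow_insert using assms disj inj
    by (subst sum.union_disjoint) (auto simp: sum.reindex)
  also have "\<dots> = (\<Sum>A\<in>Pow E. (1 - p) * (p ^ card A * (1 - p) ^ card (E - A) * F A)) +
      (\<Sum>A\<in>Pow E. p * (p ^ card A * (1 - p) ^ card (E - A) * F (insert x A)))"
    using 1 2 by (intro arg_cong2[where f = "(+)"] sum.cong) auto
  finally show ?thesis
    by (simp add: subset_mean_def sum_distrib_left)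
qed

lemma subset_mean_const [simp]: "finite E \<Longrightarrow> subset_mean E p (\<lambda>_. c) = c"
  by (induction E rule: finite_induct) (simp_all add: subset_mean_insert algebra_simps)

lemma subset_mean_add:
  "subset_mean E p (\<lambda>A. F A + F' A) = subset_mean E p F + subset_mean E p F'"
  by (simp add: subset_mean_def sum.distrib algebra_simps)

lemma subset_mean_diff:
  "subset_mean E p (\<lambda>A. F A - F' A) = subset_mean E p F - subset_mean E p F'"
  by (simp add: subset_mean_def sum_subtractf algebra_simps)

lemma subset_mean_cmult: "subset_mean E p (\<lambda>A. c * F A) = c * subset_mean E p F"
  by (simp add: subset_mean_def sum_distrib_left algebra_simps)

lemma subset_mean_sum:
  "subset_mean E p (\<lambda>A. \<Sum>i\<in>I. F i A) = (\<Sum>i\<in>I. subset_mean E p (F i))"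
  unfolding subset_mean_def by (subst sum.swap) (simp add: sum_distrib_left)

lemma subset_mean_mono:
  assumes "0 \<le> p" "p \<le> 1" "\<And>A. A \<subseteq> E \<Longrightarrow> F A \<le> F' A"
  shows "subset_mean E p F \<le> subset_mean E p F'"
  unfolding subset_mean_def using assms by (intro sum_mono mult_left_mono) auto

lemma subset_mean_avoid:
  assumes "finite E" "B \<subseteq> E"
  shows "subset_mean E p (\<lambda>A. of_bool (A \<inter> B = {})) = (1 - p) ^ card B"
  using assms
proof (induction E arbitrary: B rule: finite_induct)
  case empty
  then show ?case by simp
next
  case (insert x E)
  note fB = finite_subset[OF insert.prems finite.insertI[OF insert.hyps(1)]]
  have 1: "subset_mean E p (\<lambda>A. of_bool (A \<inter> B = {})) = (1 - p) ^ card (B - {x})"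
  proof -
    have "subset_mean E p (\<lambda>A. of_bool (A \<inter> B = {})) =
        subset_mean E p (\<lambda>A. of_bool (A \<inter> (B - {x}) = {}))"
      using insert.hyps by (intro subset_mean_cong) (auto intro!: arg_cong[where f = of_bool])
    also have "\<dots> = (1 - p) ^ card (B - {x})"
      using insert.prems by (intro insert.IH) auto
    finally show ?thesis .
  qed
  show ?case
  proof (cases "x \<in> B")
    case True
    then have "card B = Suc (card (B - {x}))"
      using fB card_Suc_Diff1 by metis
    then have "(1 - p) ^ card B = (1 - p) * (1 - p) ^ card (B - {x})" by simp
    then show ?thesis using True insert.hyps 1 by (simp add: subset_mean_insert del: card_Diff_insert)
  next
    case False
    then show ?thesis using insert.hyps 1 by (simp add: subset_mean_insert algebra_simps)
  qed
qed

text \<open>The exponential moment, at base 2, of the number of chosen elements of \<open>B\<close>;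
  it feeds the Markov bound in \<open>edge_count_tail\<close>.\<close>

lemma subset_mean_power2_card:
  assumes "finite E" "B \<subseteq> E"
  shows "subset_mean E p (\<lambda>A. 2 ^ card (A \<inter> B)) = (1 + p) ^ card B"
  using assms
proof (induction E arbitrary: B rule: finite_induct)
  case empty
  then show ?case by simp
next
  case (insert x E)
  note fB = finite_subset[OF insert.prems finite.insertI[OF insert.hyps(1)]]
  have 1: "subset_mean E p (\<lambda>A. 2 ^ card (A \<inter> B)) = (1 + p) ^ card (B - {x})"
  proof -
    have "subset_mean E p (\<lambda>A. 2 ^ card (A \<inter> B)) =
        subset_mean E p (\<lambda>A. 2 ^ card (A \<inter> (B - {x})))"
      using insert.hyps
      by (intro subset_mean_cong arg_cong[where f = "\<lambda>A. 2 ^ card A"]) auto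
    also have "\<dots> = (1 + p) ^ card (B - {x})"
      using insert.prems by (intro insert.IH) auto
    finally show ?thesis .
  qed
  show ?case
  proof (cases "x \<in> B")
    case True
    have "subset_mean E p (\<lambda>A. 2 ^ card (insert x A \<inter> B)) =
        subset_mean E p (\<lambda>A. 2 * 2 ^ card (A \<inter> B))"
    proof (intro subset_mean_cong)
      fix A assume "A \<subseteq> E"
      then have "x \<notin> A \<inter> B" "finite (A \<inter> B)" "insert x A \<inter> B = insert x (A \<inter> B)"
        using True insert.hyps fB by auto
      then show "2 ^ card (insert x A \<inter> B) = (2 * 2 ^ card (A \<inter> B) :: real)" by simp
    qed
    moreover have "card B = Suc (card (B - {x}))"
      using True fB card_Suc_Diff1 by metis
    then have "(1 + p) ^ card B = (1 + p) * (1 + p) ^ card (B - {x})" by simp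
    ultimately show ?thesis
      using insert.hyps 1
      by (simp add: subset_mean_insert subset_mean_cmult algebra_simps del: card_Diff_insert)
  next
    case False
    then show ?thesis using insert.hyps 1 by (simp add: subset_mean_insert algebra_simps)
  qed
qed

section \<open>Concentration of monotone functions that one element changes by at most 1\<close>

lemma exp_bernoulli_centred:
  fixes p d :: real
  assumes "0 \<le> p" "p \<le> 1" "0 \<le> d" "d \<le> 1"
  shows "p * exp d + (1 - p) \<le> exp (p * d + p * d\<^sup>2)"
proof -
  have "p * exp d + (1 - p) \<le> 1 + (p * d + p * d\<^sup>2)"
    using mult_left_mono[OF exp_bound[OF assms(3,4)] assms(1)] by (simp add: algebra_simps)
  also have "\<dots> \<le> exp (p * d + p * d\<^sup>2)" by (rule exp_ge_add_one_self)
  finally show ?thesis .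
qed

text \<open>The variance proxy carries the factor \<open>p\<close>, which a bounded-differences inequality
  would lose.\<close>
lemma subset_mean_exp_le:
  assumes "finite E" "0 \<le> p" "p \<le> 1" "0 \<le> lam" "lam \<le> 1"
    and "\<And>x A. x \<in> E \<Longrightarrow> A \<subseteq> E \<Longrightarrow> F (insert x A) \<le> F A"
    and "\<And>x A. x \<in> E \<Longrightarrow> A \<subseteq> E \<Longrightarrow> F A \<le> F (insert x A) + 1"
  shows "subset_mean E p (\<lambda>A. exp (- lam * F A)) \<le>
    exp (- lam * subset_mean E p F + lam\<^sup>2 * p * card E)"
  using assms(1,6,7)
proof (induction E arbitrary: F rule: finite_induct)
  case empty
  then show ?case by simp
next
  case (insert x E)
  \<comment> \<open>The means conditioned on \<open>x\<close> being in or out. Monotonicity and the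
    unit step size of \<open>F\<close> place their difference in [0, 1].\<close>
  define m1 where "m1 = subset_mean E p (\<lambda>A. F (insert x A))"
  define m0 where "m0 = subset_mean E p F"
  define c where "c = lam\<^sup>2 * p * card E"
  have "m1 \<le> m0"
    unfolding m1_def m0_def using insert.prems(1) assms(2,3)
    by (intro subset_mean_mono insert.prems(1)) auto
  moreover have "m0 \<le> m1 + 1"
  proof -
    have "m0 \<le> subset_mean E p (\<lambda>A. F (insert x A) + 1)"
      unfolding m0_def using assms(2,3) by (intro subset_mean_mono insert.prems(2)) auto
    then show ?thesis using insert.hyps by (simp add: subset_mean_add m1_def)
  qed
  ultimately have m: "0 \<le> m0 - m1" "m0 - m1 \<le> 1" by auto
  define d where "d = lam * (m0 - m1)"
  have d: "0 \<le> d" "d \<le> lam" "d \<le> 1"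
    using m assms by (auto simp: d_def mult_left_le mult_le_one)
  have "subset_mean (insert x E) p (\<lambda>A. exp (- lam * F A)) =
      p * subset_mean E p (\<lambda>A. exp (- lam * F (insert x A))) +
      (1 - p) * subset_mean E p (\<lambda>A. exp (- lam * F A))"
    using insert.hyps by (rule subset_mean_insert)
  \<comment> \<open>Both conditioned functions inherit the two hypotheses on \<open>F\<close>, so
    the induction hypothesis applies to each. What remains is the single trial at
    \<open>x\<close>.\<close>
  also have "\<dots> \<le> p * exp (- lam * m1 + c) + (1 - p) * exp (- lam * m0 + c)"
  proof -
    have "subset_mean E p (\<lambda>A. exp (- lam * F (insert x A))) \<le> exp (- lam * m1 + c)"
      unfolding m1_def c_def
      by (intro insert.IH; subst insert_commute; intro insert.prems) auto
    moreover have "subset_mean E p (\<lambda>A. exp (- lam * F A)) \<le> exp (- lam * m0 + c)"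
      unfolding m0_def c_def
      by (intro insert.IH; intro insert.prems) auto
    ultimately show ?thesis using assms by (intro add_mono mult_left_mono) auto
  qed
  also have "\<dots> = exp (- lam * m0 + c) * (p * exp d + (1 - p))"
    by (simp add: d_def algebra_simps flip: exp_add)
  also have "\<dots> \<le> exp (- lam * m0 + c) * exp (p * d + p * d\<^sup>2)"
    using assms d by (intro mult_left_mono exp_bernoulli_centred) auto
  also have "\<dots> = exp (- lam * (p * m1 + (1 - p) * m0) + (p * d\<^sup>2 + c))"
    by (simp add: d_def algebra_simps flip: exp_add)
  also have "\<dots> \<le> exp (- lam * (p * m1 + (1 - p) * m0) + (p * lam\<^sup>2 + c))"
    using assms d by (simp add: mult_left_mono power_mono)
  also have "\<dots> = exp (- lam * subset_mean (insert x E) p F + lam\<^sup>2 * p * card (insert x E))"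
    using insert.hyps by (simp add: subset_mean_insert m0_def m1_def c_def algebra_simps)
  finally show ?case .
qed

text \<open>Markov's inequality for \<open>exp (- lam * F A)\<close>. The best \<open>lam\<close>
  depends on the bounds available for the mean, so it stays free until
  \<open>cover_number_whp\<close>.\<close>

lemma subset_mean_lower_tail:
  assumes "finite E" "0 \<le> p" "p \<le> 1" "0 \<le> lam" "lam \<le> 1"
    and "\<And>x A. x \<in> E \<Longrightarrow> A \<subseteq> E \<Longrightarrow> F (insert x A) \<le> F A"
    and "\<And>x A. x \<in> E \<Longrightarrow> A \<subseteq> E \<Longrightarrow> F A \<le> F (insert x A) + 1"
    and "s + t \<le> subset_mean E p F"
  shows "subset_mean E p (\<lambda>A. of_bool (F A < s)) \<le> exp (- lam * t + lam\<^sup>2 * p * card E)"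
proof -
  have "subset_mean E p (\<lambda>A. of_bool (F A < s)) \<le>
      subset_mean E p (\<lambda>A. exp (lam * s) * exp (- lam * F A))"
    using assms(2-5) by (intro subset_mean_mono) (auto simp: mult_left_mono simp flip: exp_add)
  also have "\<dots> = exp (lam * s) * subset_mean E p (\<lambda>A. exp (- lam * F A))"
    by (rule subset_mean_cmult)
  also have "\<dots> \<le> exp (lam * s) * exp (- lam * subset_mean E p F + lam\<^sup>2 * p * card E)"
    using assms by (intro mult_left_mono subset_mean_exp_le) auto
  also have "\<dots> = exp (lam * (s - subset_mean E p F) + lam\<^sup>2 * p * card E)"
    by (simp add: algebra_simps flip: exp_add)
  also have "\<dots> \<le> exp (- lam * t + lam\<^sup>2 * p * card E)"
    using mult_left_mono[OF assms(8) assms(4)] by (simp add: algebra_simps)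
  finally show ?thesis .
qed

section \<open>The random graph as a random subset of pairs\<close>

lemma expectation_Pi_bernoulli:
  fixes F :: "'a set \<Rightarrow> real"
  assumes "finite E" "0 \<le> p" "p \<le> 1"
  shows "measure_pmf.expectation (map_pmf (\<lambda>f. {e \<in> E. f e}) (Pi_pmf E False (\<lambda>_. bernoulli_pmf p))) F
    = subset_mean E p F"
  using assms(1)
proof (induction E arbitrary: F rule: finite_induct)
  case empty
  then show ?case by simp
next
  case (insert x E)
  let ?P = "Pi_pmf E False (\<lambda>_. bernoulli_pmf p)"
  \<comment> \<open>Finite support permits the expectation of the \<open>bind\<close> to be expanded
    as a finite sum over the trial at \<open>x\<close>, which reproduces
    \<open>subset_mean_insert\<close>.\<close>
  have fin: "finite (set_pmf ?P)"
    using insert.hyps by (intro finite_subset[OF set_Pi_pmf_subset']) (auto intro: finite_PiE_dflt)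
  have "map_pmf (\<lambda>f. {e \<in> insert x E. f e}) (Pi_pmf (insert x E) False (\<lambda>_. bernoulli_pmf p)) =
      bernoulli_pmf p \<bind> (\<lambda>y. map_pmf (\<lambda>f. (if y then insert x {e \<in> E. f e} else {e \<in> E. f e})) ?P)"
    unfolding Pi_pmf_insert[OF insert.hyps] pair_pmf_def map_pmf_def bind_assoc_pmf bind_return_pmf
    using insert.hyps
    by (intro bind_pmf_cong refl) (auto intro!: arg_cong[where f = return_pmf])
  then have "measure_pmf.expectation (map_pmf (\<lambda>f. {e \<in> insert x E. f e})
        (Pi_pmf (insert x E) False (\<lambda>_. bernoulli_pmf p))) F =
      (\<Sum>y\<in>UNIV. pmf (bernoulli_pmf p) y *\<^sub>R measure_pmf.expectation
        (map_pmf (\<lambda>f. (if y then insert x {e \<in> E. f e} else {e \<in> E. f e})) ?P) F)"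
    using fin by (simp only:) (rule pmf_expectation_bind, auto)
  also have "\<dots> = p * measure_pmf.expectation (map_pmf (\<lambda>f. {e \<in> E. f e}) ?P) (\<lambda>A. F (insert x A)) +
      (1 - p) * measure_pmf.expectation (map_pmf (\<lambda>f. {e \<in> E. f e}) ?P) F"
    using assms by (simp add: UNIV_bool)
  also have "\<dots> = subset_mean (insert x E) p F"
    using subset_mean_insert[OF insert.hyps] by (simp only: insert.IH)
  finally show ?case .
qed

lemma prob_Gnp:
  assumes "0 \<le> p" "p \<le> 1"
  shows "measure_pmf.prob (Gnp n p) {G. Q G} = subset_mean (nsets {1..n} 2) p (\<lambda>A. of_bool (Q A))"
proof -
  have "measure_pmf.prob (Gnp n p) {G. Q G} = measure_pmf.expectation (Gnp n p) (indicator {G. Q G})"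
    by simp
  also have "indicator {G. Q G} = (\<lambda>A. of_bool (Q A) :: real)"
    by (auto simp: indicator_def)
  finally show ?thesis
    unfolding Gnp_def
    using expectation_Pi_bernoulli[OF finite_imp_finite_nsets[OF finite_atLeastAtMost] assms]
    by (simp only:)
qed

section \<open>Independent sets and colourings\<close>

definition indep_set :: "'a set set \<Rightarrow> 'a set \<Rightarrow> bool" where
  "indep_set E S \<longleftrightarrow> E \<inter> nsets S 2 = {}"

lemma indep_set_mono: "indep_set E S \<Longrightarrow> E' \<subseteq> E \<Longrightarrow> S' \<subseteq> S \<Longrightarrow> indep_set E' S'"
  unfolding indep_set_def using nsets_mono by blast

lemma indep_set_Un: "indep_set (E \<union> E') S \<longleftrightarrow> indep_set E S \<and> indep_set E' S"
  by (auto simp: indep_set_def)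

lemma card_nsets: "finite A \<Longrightarrow> card (nsets A k) = card A choose k"
proof -
  assume "finite A"
  then have "nsets A k = {B. B \<subseteq> A \<and> card B = k}"
    by (auto simp: nsets_def intro: finite_subset)
  then show ?thesis using n_subsets[OF \<open>finite A\<close>] by simp
qed

text \<open>The clause \<open>u \<noteq> v\<close> keeps singletons in \<open>E\<close> from
  counting, so that the handshake identity below holds for an arbitrary set system.\<close>

definition degree_in :: "'a set set \<Rightarrow> 'a set \<Rightarrow> 'a \<Rightarrow> nat" where
  "degree_in E S v = card {u \<in> S. u \<noteq> v \<and> {u, v} \<in> E}"

lemma degree_in_mono:
  "finite S \<Longrightarrow> S' \<subseteq> S \<Longrightarrow> degree_in E S' v \<le> degree_in E S v"
  unfolding degree_in_def by (intro card_mono) auto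

lemma degree_in_Un:
  "finite S \<Longrightarrow> degree_in (E \<union> E') S v \<le> degree_in E S v + degree_in E' S v"
  unfolding degree_in_def
  by (rule order_trans[OF card_mono card_Un_le]) auto

lemma sum_degree_in:
  assumes "finite S"
  shows "(\<Sum>v\<in>S. degree_in E S v) = 2 * card (E \<inter> nsets S 2)"
proof -
  \<comment> \<open>Ordered adjacent pairs, counted once by first vertex and once by underlying
    edge; exactly two of them lie over each edge.\<close>
  define D where "D = (SIGMA v:S. {u \<in> S. u \<noteq> v \<and> {u, v} \<in> E})"
  have fin: "finite D" using assms by (auto simp: D_def)
  have fE: "finite (E \<inter> nsets S 2)" using assms finite_imp_finite_nsets by blast
  have "(\<Sum>v\<in>S. degree_in E S v) = card D"
    unfolding D_def degree_in_def using assms by (subst card_SigmaI) auto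
  also have "\<dots> = (\<Sum>e\<in>E \<inter> nsets S 2. card {x \<in> D. {fst x, snd x} = e})"
  proof -
    have "D = (\<Union>e\<in>E \<inter> nsets S 2. {x \<in> D. {fst x, snd x} = e})"
      by (auto simp: D_def insert_commute)
    then have "card D = card (\<Union>e\<in>E \<inter> nsets S 2. {x \<in> D. {fst x, snd x} = e})" by simp
    also have "\<dots> = (\<Sum>e\<in>E \<inter> nsets S 2. card {x \<in> D. {fst x, snd x} = e})"
      using fin fE by (intro card_UN_disjoint) auto
    finally show ?thesis .
  qed
  also have "\<dots> = (\<Sum>e\<in>E \<inter> nsets S 2. 2)"
  proof (intro sum.cong refl)
    fix e assume "e \<in> E \<inter> nsets S 2"
    then obtain x y where e: "e = {x, y}" "x \<in> S" "y \<in> S" "x \<noteq> y" "{x, y} \<in> E"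
      by (auto elim!: nsets2_E)
    then have "{z \<in> D. {fst z, snd z} = e} = {(x, y), (y, x)}"
      by (auto simp: D_def doubleton_eq_iff insert_commute)
    then show "card {z \<in> D. {fst z, snd z} = e} = 2" using e by simp
  qed
  finally show ?thesis by simp
qed

lemma degree_in_le_max_degree:
  assumes "finite V" "simple_graph V E" "S \<subseteq> V" "v \<in> V"
  shows "degree_in E S v \<le> max_degree V E"
proof -
  have "degree_in E S v \<le> vertex_degree E v"
    unfolding degree_in_def vertex_degree_def
  proof (rule card_inj_on_le[where f = "\<lambda>u. {u, v}"])
    show "inj_on (\<lambda>u. {u, v}) {u \<in> S. u \<noteq> v \<and> {u, v} \<in> E}"
      by (auto simp: inj_on_def doubleton_eq_iff)
    show "finite {e \<in> E. v \<in> e}"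
      using assms(1,2) finite_imp_finite_nsets finite_subset unfolding simple_graph_def by fastforce
  qed auto
  also have "\<dots> \<le> max_degree V E"
    unfolding max_degree_def using assms by (intro Max_ge) auto
  finally show ?thesis .
qed

lemma card_edges_le_max_degree:
  assumes "finite V" "simple_graph V E" "S \<subseteq> V"
  shows "2 * card (E \<inter> nsets S 2) \<le> card S * max_degree V E"
proof -
  have "2 * card (E \<inter> nsets S 2) = (\<Sum>v\<in>S. degree_in E S v)"
    using assms finite_subset by (subst sum_degree_in) auto
  also have "\<dots> \<le> (\<Sum>v\<in>S. max_degree V E)"
    using assms by (intro sum_mono degree_in_le_max_degree) auto
  finally show ?thesis by simp
qed

text \<open>Greedy choice: take a vertex \<open>v\<close> of least degree and delete it with its
  neighbours. The 1 + deg v deleted vertices contribute at most 1 / (1 + deg v) each, so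
  \<open>v\<close> pays for them all. Degrees of the other vertices only drop, hence their terms
  only grow.\<close>

lemma caro_wei:
  assumes "finite S"
  shows "\<exists>I\<subseteq>S. indep_set E I \<and> (\<Sum>v\<in>S. 1 / (1 + real (degree_in E S v))) \<le> card I"
  using assms
proof (induction S rule: finite_psubset_induct)
  case (psubset S)
  show ?case
  proof (cases "S = {}")
    case True
    then show ?thesis by (auto simp: indep_set_def nsets_empty_iff)
  next
    case False
    obtain v where v: "v \<in> S" "\<And>u. u \<in> S \<Longrightarrow> degree_in E S v \<le> degree_in E S u"
      using arg_min_if_finite[OF psubset.hyps(1) False] by (metis not_le)
    define N where "N = insert v {u \<in> S. u \<noteq> v \<and> {u, v} \<in> E}"
    have N: "N \<subseteq> S" "finite N" "card N = 1 + degree_in E S v"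
      using v psubset.hyps finite_subset by (auto simp: N_def degree_in_def)
    have "S - N \<subset> S" using v by (auto simp: N_def)
    from psubset.IH[OF this] obtain I where I: "I \<subseteq> S - N" "indep_set E I"
      "(\<Sum>v\<in>S - N. 1 / (1 + real (degree_in E (S - N) v))) \<le> card I" by blast
    have fI: "finite I" using I(1) psubset.hyps finite_subset by blast
    have vI: "v \<notin> I" using I(1) by (auto simp: N_def)
    have "indep_set E (insert v I)"
      unfolding indep_set_def
    proof (intro equals0I)
      fix e assume e: "e \<in> E \<inter> nsets (insert v I) 2"
      then obtain x y where xy: "e = {x, y}" "x \<in> insert v I" "y \<in> insert v I" "x \<noteq> y"
        by (auto elim!: nsets2_E)
      have "{u, v} \<notin> E \<and> {v, u} \<notin> E" if "u \<in> I" for u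
        using I(1) that by (auto simp: N_def insert_commute)
      then have "x \<in> I" "y \<in> I" using e xy by auto
      then show False using e xy I(2) by (auto simp: indep_set_def)
    qed
    moreover have "(\<Sum>u\<in>S. 1 / (1 + real (degree_in E S u))) \<le> card (insert v I)"
    proof -
      have "(\<Sum>u\<in>S. 1 / (1 + real (degree_in E S u))) =
          (\<Sum>u\<in>N. 1 / (1 + real (degree_in E S u))) + (\<Sum>u\<in>S - N. 1 / (1 + real (degree_in E S u)))"
        using psubset.hyps N by (intro sum.subset_diff[THEN trans]) auto
      also have "(\<Sum>u\<in>N. 1 / (1 + real (degree_in E S u))) \<le> (\<Sum>u\<in>N. 1 / (1 + real (degree_in E S v)))"
        using v N by (intro sum_mono divide_left_mono) auto
      also have "\<dots> = 1" using N by simp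
      also have "(\<Sum>u\<in>S - N. 1 / (1 + real (degree_in E S u))) \<le>
          (\<Sum>u\<in>S - N. 1 / (1 + real (degree_in E (S - N) u)))"
        using psubset.hyps by (intro sum_mono divide_left_mono) (auto simp: degree_in_mono)
      finally show ?thesis using I(3) fI vI by simp
    qed
    moreover have "insert v I \<subseteq> S" using I(1) v by auto
    ultimately show ?thesis by blast
  qed
qed

text \<open>Convexity of 1 / x bounds the Caro-Wei sum by its value at the average degree, which is
  at most \<open>d\<close>.\<close>

lemma turan_independent:
  fixes d :: real
  assumes "finite S" "S \<noteq> {}" "2 * real (card (E \<inter> nsets S 2)) \<le> d * card S"
  shows "\<exists>I\<subseteq>S. indep_set E I \<and> card S / (1 + d) \<le> card I"
proof -
  have pos: "card S > 0" using assms by (simp add: card_gt_0_iff)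
  have "0 \<le> d * card S" using order_trans[OF _ assms(3)] by simp
  then have d: "0 \<le> d" using pos by (simp add: zero_le_mult_iff)
  define x where "x v = 1 + real (degree_in E S v)" for v
  \<comment> \<open>the tangent line of \<open>1 / x\<close> at \<open>1 + d\<close>\<close>
  have tangent: "2 / (1 + d) - x v / (1 + d)\<^sup>2 \<le> 1 / x v" for v
  proof -
    have "x v > 0" by (simp add: x_def)
    have "1 / t - (2 / c - t / c\<^sup>2) = (c - t)\<^sup>2 / (t * c\<^sup>2)" if "t > 0" "c > 0" for t c :: real
      using that by (simp add: field_simps power2_eq_square)
    from this[of "x v" "1 + d"]
    have "1 / x v - (2 / (1 + d) - x v / (1 + d)\<^sup>2) = (1 + d - x v)\<^sup>2 / (x v * (1 + d)\<^sup>2)"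
      using \<open>x v > 0\<close> d by simp
    also have "\<dots> \<ge> 0" using \<open>x v > 0\<close> by simp
    finally show ?thesis by simp
  qed
  have sumx: "(\<Sum>v\<in>S. x v) \<le> card S * (1 + d)"
  proof -
    have "(\<Sum>v\<in>S. x v) = card S + 2 * real (card (E \<inter> nsets S 2))"
      using arg_cong[OF sum_degree_in[OF assms(1), of E], of real] by (simp add: x_def sum.distrib)
    then show ?thesis using assms(3) by (simp add: algebra_simps)
  qed
  have "card S / (1 + d) = card S * (2 / (1 + d)) - card S * (1 + d) / (1 + d)\<^sup>2"
  proof -
    have "x / c = x * (2 / c) - x * c / c\<^sup>2" if "c > 0" for x c :: real
      using that by (simp add: field_simps power2_eq_square)
    from this[of "1 + d" "card S"] show ?thesis using d by simp
  qed
  also have "\<dots> \<le> card S * (2 / (1 + d)) - (\<Sum>v\<in>S. x v) / (1 + d)\<^sup>2"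
    using sumx by (intro diff_left_mono divide_right_mono) auto
  also have "\<dots> = (\<Sum>v\<in>S. 2 / (1 + d) - x v / (1 + d)\<^sup>2)"
    by (simp add: sum_subtractf sum_divide_distrib)
  also have "\<dots> \<le> (\<Sum>v\<in>S. 1 / x v)" by (intro sum_mono tangent)
  finally have le: "card S / (1 + d) \<le> (\<Sum>v\<in>S. 1 / x v)" .
  obtain I where "I \<subseteq> S" "indep_set E I" "(\<Sum>v\<in>S. 1 / x v) \<le> card I"
    using caro_wei[OF assms(1), of E] unfolding x_def by blast
  then show ?thesis using le by (intro exI[of _ I]) auto
qed

section \<open>Greedy colourings\<close>

lemma colourable_add_independent:
  assumes "proper_colouring (U - I) E j c" "indep_set E I" "\<And>v. {v} \<notin> E"
  shows "\<exists>c'. proper_colouring U E (Suc j) c'"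
proof
  show "proper_colouring U E (Suc j) (\<lambda>v. if v \<in> I then j else c v)"
    unfolding proper_colouring_def
  proof (intro conjI ballI impI)
    show "(\<lambda>v. if v \<in> I then j else c v) ` U \<subseteq> {..<Suc j}"
      using assms(1) by (fastforce simp: proper_colouring_def)
    fix u v assume uv: "u \<in> U" "v \<in> U" "{u, v} \<in> E"
    \<comment> \<open>\<open>proper_colouring\<close> also compares a vertex with itself, so a
      singleton edge would rule out every colouring.\<close>
    have "u \<noteq> v" using assms(3) uv by auto
    then have "\<not> (u \<in> I \<and> v \<in> I)" using assms(2) uv by (auto simp: indep_set_def)
    moreover have "c w < j" if "w \<in> U - I" for w
      using assms(1) that by (auto simp: proper_colouring_def)
    ultimately show "(if u \<in> I then j else c u) \<noteq> (if v \<in> I then j else c v)"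
      using assms(1) uv by (auto simp: proper_colouring_def dest: less_imp_neq)
  qed
qed

text \<open>Colour a vertex of degree at most \<open>d\<close> last: its neighbours block at most
  \<open>d\<close> of the \<open>Suc d\<close> colours.\<close>

lemma colourable_degenerate:
  assumes "finite S" "\<And>v. {v} \<notin> E"
    and "\<And>T. T \<subseteq> S \<Longrightarrow> T \<noteq> {} \<Longrightarrow> \<exists>v\<in>T. degree_in E T v \<le> d"
  shows "\<exists>c. proper_colouring S E (Suc d) c"
  using assms(1,3)
proof (induction S rule: finite_psubset_induct)
  case (psubset S)
  show ?case
  proof (cases "S = {}")
    case True
    then show ?thesis by (auto simp: proper_colouring_def)
  next
    case False
    then obtain v where v: "v \<in> S" "degree_in E S v \<le> d" using psubset.prems by blast
    have "S - {v} \<subset> S" using v by auto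
    from psubset.IH[OF this] psubset.prems obtain c where c: "proper_colouring (S - {v}) E (Suc d) c"
      by (metis Diff_subset order_trans)
    define N where "N = {u \<in> S. u \<noteq> v \<and> {u, v} \<in> E}"
    have "card (c ` N) < Suc d"
      using v psubset.hyps card_image_le[of N c] by (auto simp: degree_in_def N_def)
    then have "\<not> {..<Suc d} \<subseteq> c ` N"
      using card_mono[of "c ` N" "{..<Suc d}"] psubset.hyps by (auto simp: N_def)
    then obtain a where a: "a < Suc d" "a \<notin> c ` N" by auto
    have "proper_colouring S E (Suc d) (c(v := a))"
      unfolding proper_colouring_def
    proof (intro conjI ballI impI)
      show "(c(v := a)) ` S \<subseteq> {..<Suc d}"
        using c a by (auto simp: proper_colouring_def)
      fix x y assume xy: "x \<in> S" "y \<in> S" "{x, y} \<in> E"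
      have "x \<noteq> y" using assms(2) xy by auto
      consider "x = v" | "y = v" | "x \<noteq> v" "y \<noteq> v" by blast
      then show "(c(v := a)) x \<noteq> (c(v := a)) y"
      proof cases
        case 1
        then have "y \<in> N" using xy \<open>x \<noteq> y\<close> by (auto simp: N_def insert_commute)
        then show ?thesis using 1 a \<open>x \<noteq> y\<close> by auto
      next
        case 2
        then have "x \<in> N" using xy \<open>x \<noteq> y\<close> by (auto simp: N_def)
        then show ?thesis using 2 a \<open>x \<noteq> y\<close> by auto
      next
        case 3
        then show ?thesis using c xy by (auto simp: proper_colouring_def)
      qed
    qed
    then show ?thesis by blast
  qed
qed

lemma exists_small_degree:
  fixes d :: real
  assumes "finite S" "S \<noteq> {}" "2 * real (card (E \<inter> nsets S 2)) \<le> d * card S"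
  shows "\<exists>v\<in>S. real (degree_in E S v) \<le> d"
proof (rule ccontr)
  assume "\<not> ?thesis"
  then have "(\<Sum>v\<in>S. d) < (\<Sum>v\<in>S. real (degree_in E S v))"
    using assms by (intro sum_strict_mono) auto
  also have "\<dots> = 2 * real (card (E \<inter> nsets S 2))"
    using arg_cong[OF sum_degree_in[OF assms(1), of E], of real] by simp
  finally show False using assms by (simp add: mult.commute)
qed

text \<open>Each colour class removed from a set of \<open>m\<close> vertices has at least
  \<open>1 / (1 / k + a / m)\<close> vertices, so the number of colours is bounded by the integral of
  \<open>1 / k + a / m\<close>.\<close>
lemma colourable_by_extraction:
  fixes a m0 k R :: real
  assumes "finite U" "\<And>v. {v} \<notin> E" "0 < m0" "0 < k" "0 \<le> a" "0 \<le> R"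
    and small: "\<And>S. S \<subseteq> U \<Longrightarrow> card S < m0 \<Longrightarrow> \<exists>j c. proper_colouring S E j c \<and> real j \<le> R"
    and large: "\<And>S. S \<subseteq> U \<Longrightarrow> m0 \<le> card S \<Longrightarrow>
      \<exists>I\<subseteq>S. indep_set E I \<and> 1 \<le> card I * (1 / k + a / card S)"
  shows "\<exists>j c. proper_colouring U E j c \<and>
    real j \<le> R + (if card U < m0 then 0 else 1 + card U / k + a * ln (card U / m0))"
  using assms(1) small large
proof (induction U rule: finite_psubset_induct)
  case (psubset U)
  show ?case
  proof (cases "card U < m0")
    case True
    then show ?thesis using psubset.prems(1)[of U] by auto
  next
    case False
    then obtain I where I: "I \<subseteq> U" "indep_set E I" "1 \<le> card I * (1 / k + a / card U)"
      using psubset.prems(2)[of U] by auto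
    have fI: "finite I" using I psubset.hyps finite_subset by blast
    have "I \<noteq> {}" using I(3) by auto
    have psub: "U - I \<subset> U" using \<open>I \<noteq> {}\<close> I(1) by auto
    obtain j c where jc: "proper_colouring (U - I) E j c"
      "real j \<le> R + (if card (U - I) < m0 then 0 else 1 + card (U - I) / k + a * ln (card (U - I) / m0))"
    proof -
      have "\<exists>j c. proper_colouring (U - I) E j c \<and> real j \<le>
          R + (if card (U - I) < m0 then 0 else 1 + card (U - I) / k + a * ln (card (U - I) / m0))"
        by (rule psubset.IH[OF psub]; rule psubset.prems) auto
      then show ?thesis using that by blast
    qed
    obtain c' where c': "proper_colouring U E (Suc j) c'"
      using colourable_add_independent[OF jc(1) I(2) assms(2)] by blast
    have Upos: "0 < real (card U)" using False assms by linarith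
    have "real (Suc j) \<le> R + (1 + card U / k + a * ln (card U / m0))"
    proof (cases "card (U - I) < m0")
      case True
      \<comment> \<open>When the size first drops below \<open>m0\<close>, the additive 1 in the
        bound pays for the class just removed.\<close>
      have "0 \<le> a * ln (card U / m0)" using False assms by simp
      moreover have "0 \<le> card U / k" using assms by simp
      ultimately show ?thesis using jc True by simp
    next
      case F2: False
      define s where "s = real (card I)"
      define m where "m = real (card U)"
      have cUI: "real (card (U - I)) = m - s"
        using I fI card_mono[OF psubset.hyps(1) I(1)]
        by (simp add: card_Diff_subset of_nat_diff m_def s_def)
      have pos: "0 < m - s" "0 < m" using F2 assms cUI Upos by (auto simp: m_def)
      \<comment> \<open>By ln (1 - s / m) \<le> - s / m, removing \<open>s\<close> vertices lowers
        the bound by at least s * (1 / k + a / m) \<ge> 1, the price of one colour.\<close>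
      have "ln ((m - s) / m0) \<le> ln (m / m0) - s / m"
      proof -
        have "ln ((m - s) / m) \<le> (m - s) / m - 1"
          using pos by (intro ln_le_minus_one) auto
        moreover have "ln ((m - s) / m0) = ln (m / m0) + ln ((m - s) / m)"
          using pos assms(3) ln_divide_pos[of "m - s" m0] ln_divide_pos[of m m0]
            ln_divide_pos[of "m - s" m] by simp
        moreover have "(m - s) / m - 1 = - (s / m)" using pos by (simp add: field_simps)
        ultimately show ?thesis by simp
      qed
      then have "a * ln ((m - s) / m0) \<le> a * (ln (m / m0) - s / m)"
        using assms by (intro mult_left_mono) auto
      then have "1 + (m - s) / k + a * ln ((m - s) / m0) \<le>
          1 + m / k + a * ln (m / m0) - s * (1 / k + a / m)"
        by (simp add: algebra_simps diff_divide_distrib)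
      moreover have "1 \<le> s * (1 / k + a / m)" using I(3) by (simp add: s_def m_def)
      ultimately show ?thesis using jc(2) F2 cUI by (simp add: m_def)
    qed
    then show ?thesis using c' False by auto
  qed
qed

lemma chromatic_number_le: "proper_colouring V E j c \<Longrightarrow> chromatic_number V E \<le> j"
  unfolding chromatic_number_def by (rule Least_le) blast

section \<open>Fractional covers of independent sets\<close>

text \<open>The linear relaxation of hitting every independent k-subset of \<open>U\<close> with a
  pair. The cap \<open>y e \<le> 1\<close> limits the loss from a violated packing constraint in
  \<open>cover_number_ge_packing\<close>.\<close>

definition fractional_covers :: "'a set set \<Rightarrow> 'a set \<Rightarrow> nat \<Rightarrow> ('a set \<Rightarrow> real) set" where
  "fractional_covers G U k = {y. (\<forall>e. 0 \<le> y e \<and> y e \<le> 1) \<and>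
     (\<forall>K\<in>nsets U k. indep_set G K \<longrightarrow> 1 \<le> (\<Sum>e\<in>nsets K 2. y e))}"

text \<open>For k \<ge> 2 the constant 1 is a cover, and costs are nonnegative, so the real infimum
  is meaningful.\<close>

definition cover_number :: "'a set set \<Rightarrow> 'a set \<Rightarrow> nat \<Rightarrow> real" where
  "cover_number G U k = (INF y\<in>fractional_covers G U k. \<Sum>e\<in>nsets U 2. y e)"

lemma choose_two_pos: "2 \<le> k \<Longrightarrow> 1 \<le> k choose 2"
  by (simp add: Suc_le_eq)

lemma one_fractional_cover: "2 \<le> k \<Longrightarrow> (\<lambda>_. 1) \<in> fractional_covers G U k"
  using choose_two_pos[of k] by (auto simp: fractional_covers_def nsets_def[of U k] card_nsets)

lemma cover_number_le:
  assumes "y \<in> fractional_covers G U k"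
  shows "cover_number G U k \<le> (\<Sum>e\<in>nsets U 2. y e)"
  unfolding cover_number_def using assms
  by (intro cINF_lower bdd_belowI[where m = 0])
    (auto simp: fractional_covers_def intro: sum_nonneg)

lemma cover_number_ge:
  assumes "2 \<le> k" "\<And>y. y \<in> fractional_covers G U k \<Longrightarrow> c \<le> (\<Sum>e\<in>nsets U 2. y e)"
  shows "c \<le> cover_number G U k"
  unfolding cover_number_def using one_fractional_cover[OF assms(1)] assms(2)
  by (intro cINF_greatest) auto

text \<open>A larger graph has fewer independent sets, hence fewer constraints on a cover.\<close>

lemma cover_number_insert_le:
  assumes "2 \<le> k"
  shows "cover_number (insert e G) U k \<le> cover_number G U k"
proof (intro cover_number_ge[OF assms] cover_number_le)
  fix y assume "y \<in> fractional_covers G U k"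
  then show "y \<in> fractional_covers (insert e G) U k"
    unfolding fractional_covers_def indep_set_def by blast
qed

text \<open>Adding \<open>e\<close> destroys only independent sets that contain this pair, and
  raising the weight of \<open>e\<close> to 1 hits all of them at an extra cost of at most
  1.\<close>

lemma cover_number_le_insert:
  assumes "2 \<le> k" "finite U"
  shows "cover_number G U k \<le> cover_number (insert e G) U k + 1"
proof -
  have "cover_number G U k - 1 \<le> cover_number (insert e G) U k"
  proof (intro cover_number_ge[OF assms(1)])
    fix y assume y: "y \<in> fractional_covers (insert e G) U k"
    have y01: "0 \<le> y e'" "y e' \<le> 1" for e' using y by (auto simp: fractional_covers_def)
    have "y(e := 1) \<in> fractional_covers G U k"
      unfolding fractional_covers_def
    proof (intro CollectI conjI allI ballI impI)
      fix K assume K: "K \<in> nsets U k" "indep_set G K"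
      have fK: "finite (nsets K 2)" using K(1) by (auto simp: nsets_def)
      show "1 \<le> (\<Sum>e'\<in>nsets K 2. (y(e := 1)) e')"
      proof (cases "e \<in> nsets K 2")
        case True
        have "(y(e := 1)) e \<le> (\<Sum>e'\<in>nsets K 2. (y(e := 1)) e')"
          using fK True y01 by (intro member_le_sum) auto
        then show ?thesis by simp
      next
        case False
        then have "indep_set (insert e G) K" using K by (auto simp: indep_set_def)
        then have "1 \<le> (\<Sum>e'\<in>nsets K 2. y e')" using y K by (auto simp: fractional_covers_def)
        also have "\<dots> = (\<Sum>e'\<in>nsets K 2. (y(e := 1)) e')" using False by (intro sum.cong) auto
        finally show ?thesis .
      qed
    qed (use y01 in auto)
    then have "cover_number G U k \<le> (\<Sum>e'\<in>nsets U 2. (y(e := 1)) e')" by (rule cover_number_le)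
    also have "\<dots> \<le> (\<Sum>e'\<in>nsets U 2. y e' + of_bool (e' = e))"
      using y01 by (intro sum_mono) auto
    also have "\<dots> \<le> (\<Sum>e'\<in>nsets U 2. y e') + 1"
      using assms(2) by (simp add: sum.distrib finite_imp_finite_nsets of_bool_def)
    finally show "cover_number G U k - 1 \<le> (\<Sum>e'\<in>nsets U 2. y e')" by simp
  qed
  then show ?thesis by simp
qed

text \<open>Weak LP duality, for weights \<open>a\<close> on the independent \<open>k\<close>-sets that may violate the packing
  constraints; the total violation is subtracted.\<close>
lemma cover_number_ge_packing:
  fixes a :: real
  assumes "finite U" "2 \<le> k" "0 \<le> a"
  shows "a * card {K \<in> nsets U k. indep_set G K} -
      (\<Sum>e\<in>nsets U 2. max 0 (a * card {K \<in> nsets U k. e \<subseteq> K \<and> indep_set G K} - 1))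
    \<le> cover_number G U k"
proof (intro cover_number_ge[OF assms(2)])
  fix y assume y: "y \<in> fractional_covers G U k"
  have y01: "0 \<le> y e" "y e \<le> 1" for e using y by (auto simp: fractional_covers_def)
  let ?I = "{K \<in> nsets U k. indep_set G K}"
  let ?Y = "\<lambda>e. card {K \<in> nsets U k. e \<subseteq> K \<and> indep_set G K}"
  have fU: "finite (nsets U 2)" "finite ?I" using assms by (auto simp: finite_imp_finite_nsets)
  have "real (card ?I) = (\<Sum>K\<in>?I. 1)" by simp
  also have "\<dots> \<le> (\<Sum>K\<in>?I. \<Sum>e\<in>nsets K 2. y e)"
    using y by (intro sum_mono) (auto simp: fractional_covers_def)
  also have "\<dots> = (\<Sum>K\<in>?I. \<Sum>e\<in>nsets U 2. if e \<subseteq> K then y e else 0)"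
  proof (rule sum.cong[OF refl])
    fix K assume "K \<in> ?I"
    then have "nsets K 2 = {e \<in> nsets U 2. e \<subseteq> K}" by (auto simp: nsets_def)
    then show "(\<Sum>e\<in>nsets K 2. y e) = (\<Sum>e\<in>nsets U 2. if e \<subseteq> K then y e else 0)"
      using fU by (simp add: sum.inter_filter)
  qed
  also have "\<dots> = (\<Sum>e\<in>nsets U 2. \<Sum>K\<in>?I. if e \<subseteq> K then y e else 0)" by (rule sum.swap)
  also have "\<dots> = (\<Sum>e\<in>nsets U 2. ?Y e * y e)"
  proof (intro sum.cong refl)
    fix e
    have "{K \<in> ?I. e \<subseteq> K} = {K \<in> nsets U k. e \<subseteq> K \<and> indep_set G K}" by auto
    then show "(\<Sum>K\<in>?I. if e \<subseteq> K then y e else 0) = ?Y e * y e"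
      using fU by (simp flip: sum.inter_filter)
  qed
  finally have "a * card ?I \<le> a * (\<Sum>e\<in>nsets U 2. ?Y e * y e)"
    using assms by (intro mult_left_mono)
  also have "\<dots> = (\<Sum>e\<in>nsets U 2. a * ?Y e * y e)" by (simp add: sum_distrib_left mult.assoc)
  also have "\<dots> \<le> (\<Sum>e\<in>nsets U 2. y e + max 0 (a * ?Y e - 1))"
  proof (intro sum_mono)
    fix e
    \<comment> \<open>Split the load times \<open>y e\<close> into \<open>y e\<close> itself and the
      excess over capacity 1; since \<open>y e \<le> 1\<close>, the excess is charged at most
      once.\<close>
    have "(a * ?Y e - 1) * y e \<le> max 0 (a * ?Y e - 1) * y e"
      using y01 by (intro mult_right_mono) auto
    also have "\<dots> \<le> max 0 (a * ?Y e - 1)"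
      using y01[of e] by (intro mult_left_le) auto
    finally show "a * ?Y e * y e \<le> y e + max 0 (a * ?Y e - 1)" by (simp add: algebra_simps)
  qed
  finally show "a * card ?I - (\<Sum>e\<in>nsets U 2. max 0 (a * ?Y e - 1)) \<le> (\<Sum>e\<in>nsets U 2. y e)"
    by (simp add: sum.distrib)
qed

section \<open>Second moment of the number of independent sets through a pair\<close>

lemma card_supersets:
  assumes "finite U" "T \<subseteq> U" "card T \<le> k"
  shows "card {K \<in> nsets U k. T \<subseteq> K} = (card U - card T) choose (k - card T)"
proof -
  have fT: "finite T" using assms finite_subset by blast
  have un: "card (J \<union> T) = k" if "J \<subseteq> U - T" "finite J" "card J = k - card T" for J
    using that fT assms(3) by (subst card_Un_disjoint) auto
  have "bij_betw (\<lambda>K. K - T) {K \<in> nsets U k. T \<subseteq> K} (nsets (U - T) (k - card T))"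
    using assms fT
    by (intro bij_betwI[where g = "\<lambda>J. J \<union> T"])
      (auto simp: nsets_def card_Diff_subset un)
  then have "card {K \<in> nsets U k. T \<subseteq> K} = card (nsets (U - T) (k - card T))"
    by (rule bij_betw_same_card)
  then show ?thesis using assms fT by (simp add: card_nsets card_Diff_subset)
qed

text \<open>Each unit step multiplies by some (a - i) / (M - i), which is at most (a + 2) / (M + 2)
  as a \<le> M. The shift by 2 makes the ratio k / card U when a = k - 2 and M = card U - 2.\<close>

lemma binomial_descend:
  assumes "a \<le> M" "j \<le> a"
  shows "real ((M - j) choose (a - j)) \<le> real (M choose a) * (real (a + 2) / real (M + 2)) ^ j"
  using assms(2)
proof (induction j)
  case 0
  then show ?case by simp
next
  case (Suc j)
  define x where "x = M - j"
  define y where "y = a - j"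
  have xy: "0 < y" "y \<le> x" using Suc assms by (auto simp: x_def y_def)
  have "y * (x choose y) = x * ((x - 1) choose (y - 1))"
    using xy by (intro times_binomial_minus1_eq) auto
  then have "real y * real (x choose y) = real x * real ((x - 1) choose (y - 1))"
    by (metis of_nat_mult)
  then have "real ((x - 1) choose (y - 1)) = real (x choose y) * (real y / real x)"
    using xy by (simp add: field_simps)
  also have "\<dots> \<le> real (x choose y) * (real (a + 2) / real (M + 2))"
  proof (intro mult_left_mono)
    have "y * (M + 2) \<le> (a + 2) * x"
    proof -
      have M: "M = x + j" "a = y + j" using Suc assms by (auto simp: x_def y_def)
      have "y * (j + 2) \<le> x * (j + 2)" using xy by (intro mult_le_mono1)
      then show ?thesis unfolding M by (simp add: distrib_left distrib_right mult.commute)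
    qed
    then have "real y * real (M + 2) \<le> real (a + 2) * real x" by (metis of_nat_mono of_nat_mult)
    then show "real y / real x \<le> real (a + 2) / real (M + 2)"
      using xy by (simp add: field_simps)
  qed auto
  also have "\<dots> \<le> (real (M choose a) * (real (a + 2) / real (M + 2)) ^ j) * (real (a + 2) / real (M + 2))"
    using Suc by (intro mult_right_mono) (auto simp: x_def y_def)
  finally show ?case by (simp add: x_def y_def algebra_simps)
qed

text \<open>Bounds the relative variance of the number of independent \<open>k\<close>-sets through a fixed pair; the
  index \<open>j\<close> counts the common vertices of two such sets outside the pair.\<close>
definition overlap_sum :: "nat \<Rightarrow> real \<Rightarrow> real \<Rightarrow> real" where
  "overlap_sum k \<rho> b = (\<Sum>j=1..k - 2. real ((k - 2) choose j) * \<rho> ^ j * (b ^ (((j + 2) choose 2) - 1) - 1))"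

text \<open>Classify \<open>K'\<close> by the number \<open>j\<close> of vertices shared with
  \<open>K\<close> outside \<open>e\<close>: there are (k - 2 choose j) ways to pick them, and
  forcing them into \<open>K'\<close> brings a factor of at most (k / card U) ^ j by
  \<open>binomial_descend\<close>.\<close>

lemma overlap_sum_bound:
  fixes b :: real
  assumes "finite U" "e \<in> nsets U 2" "K \<in> nsets U k" "e \<subseteq> K" "1 \<le> b"
  shows "(\<Sum>K'\<in>{K' \<in> nsets U k. e \<subseteq> K'}. b ^ ((card (K \<inter> K') choose 2) - 1) - 1) \<le>
    real ((card U - 2) choose (k - 2)) * overlap_sum k (real k / card U) b"
proof -
  define g where "g j = b ^ (((j + 2) choose 2) - 1) - 1" for j
  \<comment> \<open>Sets \<open>K'\<close> meeting \<open>K\<close> only in \<open>e\<close> share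
    no other pair, so they contribute nothing and the sum may start at 1.\<close>
  have g0: "g 0 = 0" by (simp add: g_def numeral_2_eq_2)
  have gpos: "0 \<le> g j" for j using assms by (simp add: g_def)
  have e: "finite e" "card e = 2" "e \<subseteq> U" using assms by (auto simp: nsets_def)
  have K: "finite K" "card K = k" "K \<subseteq> U" using assms by (auto simp: nsets_def)
  have k2: "2 \<le> k" using card_mono[OF K(1) assms(4)] e K by simp
  have kU: "k \<le> card U" using card_mono[OF assms(1) K(3)] K by simp
  let ?S = "{K' \<in> nsets U k. e \<subseteq> K'}"
  have fS: "finite ?S" using assms by (simp add: finite_imp_finite_nsets)
  have card2: "2 \<le> card (K \<inter> K')" "card (K \<inter> K') \<le> k" if "K' \<in> ?S" for K'
  proof -
    have "e \<subseteq> K \<inter> K'" using that assms by auto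
    then show "2 \<le> card (K \<inter> K')" using card_mono[of "K \<inter> K'" e] e K by simp
    show "card (K \<inter> K') \<le> k" using card_mono[of K "K \<inter> K'"] K by auto
  qed
  have "(\<Sum>K'\<in>?S. b ^ ((card (K \<inter> K') choose 2) - 1) - 1) = (\<Sum>K'\<in>?S. g (card (K \<inter> K') - 2))"
  proof (intro sum.cong refl)
    fix K' assume "K' \<in> ?S"
    from card2(1)[OF this] have "card (K \<inter> K') - 2 + 2 = card (K \<inter> K')" by simp
    then show "b ^ ((card (K \<inter> K') choose 2) - 1) - 1 = g (card (K \<inter> K') - 2)"
      unfolding g_def by (simp only:)
  qed
  also have "\<dots> = (\<Sum>j\<in>{0..k - 2}. \<Sum>K'\<in>{K' \<in> ?S. card (K \<inter> K') - 2 = j}. g (card (K \<inter> K') - 2))"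
    using fS by (intro sum.group[symmetric]) (auto intro!: diff_le_mono card2)
  also have "\<dots> = (\<Sum>j\<in>{0..k - 2}. card {K' \<in> ?S. card (K \<inter> K') - 2 = j} * g j)"
    by (intro sum.cong refl) simp
  also have "\<dots> = (\<Sum>j=1..k - 2. card {K' \<in> ?S. card (K \<inter> K') - 2 = j} * g j)"
    by (simp add: sum.atLeast_Suc_atMost g0)
  also have "\<dots> \<le> (\<Sum>j=1..k - 2. (real ((k - 2) choose j) *
      (real ((card U - 2) choose (k - 2)) * (real k / card U) ^ j)) * g j)"
  proof (intro sum_mono mult_right_mono gpos)
    fix j assume j: "j \<in> {1..k - 2}"
    \<comment> \<open>Only containment of the common vertices is retained. This overcounts, but
      leaves a single binomial coefficient for each choice of \<open>J\<close>.\<close>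
    have "{K' \<in> ?S. card (K \<inter> K') - 2 = j} \<subseteq>
        (\<Union>J\<in>nsets (K - e) j. {K' \<in> nsets U k. e \<union> J \<subseteq> K'})"
    proof
      fix K' assume K': "K' \<in> {K' \<in> ?S. card (K \<inter> K') - 2 = j}"
      have "e \<subseteq> K \<inter> K'" using K' assms by auto
      then have "card ((K \<inter> K') - e) = j" using K' e K by (simp add: card_Diff_subset)
      then have "(K \<inter> K') - e \<in> nsets (K - e) j" using K by (auto simp: nsets_def)
      moreover have "e \<union> ((K \<inter> K') - e) \<subseteq> K'" using K' by auto
      ultimately show "K' \<in> (\<Union>J\<in>nsets (K - e) j. {K' \<in> nsets U k. e \<union> J \<subseteq> K'})"
        using K' by blast
    qed
    then have "card {K' \<in> ?S. card (K \<inter> K') - 2 = j} \<le>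
        card (\<Union>J\<in>nsets (K - e) j. {K' \<in> nsets U k. e \<union> J \<subseteq> K'})"
      using assms K by (intro card_mono) (auto simp: finite_imp_finite_nsets)
    also have "\<dots> \<le> (\<Sum>J\<in>nsets (K - e) j. card {K' \<in> nsets U k. e \<union> J \<subseteq> K'})"
      using K by (intro card_UN_le) (auto simp: finite_imp_finite_nsets)
    also have "\<dots> = (\<Sum>J\<in>nsets (K - e) j. (card U - 2 - j) choose (k - 2 - j))"
    proof (intro sum.cong refl)
      fix J assume J: "J \<in> nsets (K - e) j"
      then have "e \<inter> J = {}" "finite J" "card J = j" "J \<subseteq> U" using K by (auto simp: nsets_def)
      then have "card (e \<union> J) = 2 + j" "e \<union> J \<subseteq> U"
        using e by (auto simp: card_Un_disjoint)
      then show "card {K' \<in> nsets U k. e \<union> J \<subseteq> K'} = (card U - 2 - j) choose (k - 2 - j)"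
        using j k2 assms(1) by (subst card_supersets) auto
    qed
    also have "\<dots> = ((k - 2) choose j) * ((card U - 2 - j) choose (k - 2 - j))"
      using K e assms by (simp add: card_nsets card_Diff_subset)
    finally have "real (card {K' \<in> ?S. card (K \<inter> K') - 2 = j}) \<le>
        real (((k - 2) choose j) * ((card U - 2 - j) choose (k - 2 - j)))"
      by (rule of_nat_mono)
    also have "\<dots> = real ((k - 2) choose j) * real ((card U - 2 - j) choose (k - 2 - j))"
      by (rule of_nat_mult)
    also have "\<dots> \<le> real ((k - 2) choose j) *
        (real ((card U - 2) choose (k - 2)) * (real k / card U) ^ j)"
      using binomial_descend[of "k - 2" "card U - 2" j] j k2 kU by (intro mult_left_mono) auto
    finally show "real (card {K' \<in> ?S. card (K \<inter> K') - 2 = j}) \<le> \<dots>" .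
  qed
  also have "\<dots> = real ((card U - 2) choose (k - 2)) * overlap_sum k (real k / card U) b"
    by (simp add: overlap_sum_def g_def sum_distrib_left algebra_simps)
  finally show ?thesis .
qed

lemma nsets_Int: "nsets A k \<inter> nsets B k = nsets (A \<inter> B) k"
  by (auto simp: nsets_def)

lemma mean_indep_set:
  assumes "finite V" "K \<subseteq> V"
  shows "subset_mean (nsets V 2) p (\<lambda>G. of_bool (indep_set G K)) = (1 - p) ^ (card K choose 2)"
proof -
  have "finite K" using assms finite_subset by blast
  then show ?thesis
    unfolding indep_set_def using assms
    by (subst subset_mean_avoid) (auto simp: finite_imp_finite_nsets nsets_mono card_nsets)
qed

text \<open>Each event says that a set of pairs is avoided, so the joint event avoids the union.
  Every shared pair other than \<open>e\<close> is counted once instead of twice, which gains a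
  factor 1 / (1 - p) over independence.\<close>

lemma mean_indep_set_minus_pair:
  fixes p :: real
  assumes "finite V" "K \<subseteq> V" "K' \<subseteq> V" "card K = k" "card K' = k"
    "e \<subseteq> K" "e \<subseteq> K'" "card e = 2" "p < 1"
  shows "subset_mean (nsets V 2) p (\<lambda>G. of_bool (indep_set (G - {e}) K)) =
      (1 - p) ^ ((k choose 2) - 1)" (is ?A)
    and "subset_mean (nsets V 2) p (\<lambda>G. of_bool (indep_set (G - {e}) K) * of_bool (indep_set (G - {e}) K')) =
      ((1 - p) ^ ((k choose 2) - 1))\<^sup>2 * (1 / (1 - p)) ^ ((card (K \<inter> K') choose 2) - 1)" (is ?B)
proof -
  have fin: "finite K" "finite K'" "finite (nsets V 2)"
    using assms finite_subset by (auto simp: finite_imp_finite_nsets)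
  have e: "e \<in> nsets K 2" "e \<in> nsets K' 2" "e \<in> nsets (K \<inter> K') 2"
    using assms fin by (auto simp: nsets_def intro: finite_subset)
  have eq: "indep_set (G - {e}) K'' \<longleftrightarrow> G \<inter> (nsets K'' 2 - {e}) = {}" for G :: "'a set set" and K''
    by (auto simp: indep_set_def)
  have cK: "card (nsets K 2 - {e}) = (k choose 2) - 1" "card (nsets K' 2 - {e}) = (k choose 2) - 1"
    using e fin assms by (auto simp: card_nsets)
  show ?A
    unfolding eq using assms fin cK nsets_mono[of K V 2] by (subst subset_mean_avoid) auto
  have "card ((nsets K 2 - {e}) \<union> (nsets K' 2 - {e})) + card ((nsets K 2 - {e}) \<inter> (nsets K' 2 - {e})) =
      2 * ((k choose 2) - 1)"
    using card_Un_Int[of "nsets K 2 - {e}" "nsets K' 2 - {e}"] fin cK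
    by (simp add: finite_imp_finite_nsets)
  moreover have "(nsets K 2 - {e}) \<inter> (nsets K' 2 - {e}) = nsets (K \<inter> K') 2 - {e}"
    using nsets_Int[of K 2 K'] by blast
  moreover have "card (nsets (K \<inter> K') 2 - {e}) = (card (K \<inter> K') choose 2) - 1"
    using e fin by (simp add: card_nsets)
  ultimately have c: "card ((nsets K 2 - {e}) \<union> (nsets K' 2 - {e})) + ((card (K \<inter> K') choose 2) - 1) =
      2 * ((k choose 2) - 1)" by simp
  have "subset_mean (nsets V 2) p (\<lambda>G. of_bool (indep_set (G - {e}) K) * of_bool (indep_set (G - {e}) K')) =
      subset_mean (nsets V 2) p (\<lambda>G. of_bool (G \<inter> ((nsets K 2 - {e}) \<union> (nsets K' 2 - {e})) = {}))"
    unfolding eq by (intro subset_mean_cong) (auto simp: Int_Un_distrib)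
  also have "\<dots> = (1 - p) ^ card ((nsets K 2 - {e}) \<union> (nsets K' 2 - {e}))"
    using fin nsets_mono[of K V 2] nsets_mono[of K' V 2] assms by (intro subset_mean_avoid) auto
  also have "\<dots> = ((1 - p) ^ ((k choose 2) - 1))\<^sup>2 * (1 / (1 - p)) ^ ((card (K \<inter> K') choose 2) - 1)"
  proof -
    have "((1 - p) ^ ((k choose 2) - 1))\<^sup>2 =
        (1 - p) ^ card ((nsets K 2 - {e}) \<union> (nsets K' 2 - {e})) * (1 - p) ^ ((card (K \<inter> K') choose 2) - 1)"
      unfolding power_mult[symmetric] power_add[symmetric] c by (simp add: mult.commute)
    then show ?thesis using assms by (simp add: power_divide)
  qed
  finally show ?B .
qed

text \<open>The second moment method for the number \<open>Z\<close> of \<open>k\<close>-sets containing the pair \<open>e\<close> that are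
  independent apart from \<open>e\<close> itself.\<close>
lemma mean_square_deviation:
  fixes p :: real
  assumes "finite V" "U \<subseteq> V" "2 \<le> k" "k \<le> card U" "0 \<le> p" "p < 1" "e \<in> nsets U 2"
  defines "Z \<equiv> \<lambda>G. real (card {K \<in> nsets U k. e \<subseteq> K \<and> indep_set (G - {e}) K})"
    and "a \<equiv> 1 / (2 * real ((card U - 2) choose (k - 2)) * (1 - p) ^ ((k choose 2) - 1))"
  shows "subset_mean (nsets V 2) p (\<lambda>G. (a * Z G - 1 / 2)\<^sup>2) \<le>
    overlap_sum k (real k / card U) (1 / (1 - p)) / 4"
proof -
  define S where "S = {K \<in> nsets U k. e \<subseteq> K}"
  define M where "M = real ((card U - 2) choose (k - 2))"
  define q where "q = (1 - p) ^ ((k choose 2) - 1)"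
  define r where "r = overlap_sum k (real k / card U) (1 / (1 - p))"
  let ?m = "subset_mean (nsets V 2) p"
  let ?I = "\<lambda>G K. of_bool (indep_set (G - {e}) K) :: real"
  have fU: "finite U" using assms finite_subset by blast
  have fS: "finite S" using fU by (simp add: S_def finite_imp_finite_nsets)
  have e: "card e = 2" "e \<subseteq> U" using assms by (auto simp: nsets_def)
  have Mpos: "0 < M" using assms by (simp add: M_def)
  have qpos: "0 < q" using assms by (simp add: q_def)
  have cS: "real (card S) = M"
    unfolding S_def M_def using card_supersets[OF fU e(2), of k] e assms by simp
  have fE: "finite (nsets V 2)" using assms by (simp add: finite_imp_finite_nsets)
  have SD: "K \<subseteq> V" "card K = k" "e \<subseteq> K" "K \<in> nsets U k" if "K \<in> S" for K
    using that assms by (auto simp: S_def nsets_def)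
  have Z: "Z G = (\<Sum>K\<in>S. ?I G K)" for G
  proof -
    have "{K \<in> nsets U k. e \<subseteq> K \<and> indep_set (G - {e}) K} = S \<inter> {K. indep_set (G - {e}) K}"
      by (auto simp: S_def)
    then show ?thesis using fS by (simp add: Z_def sum_of_bool_eq)
  qed
  have mZ: "?m Z = M * q"
    unfolding Z subset_mean_sum
    using mean_indep_set_minus_pair(1)[OF assms(1) SD(1) SD(1) SD(2) SD(2) SD(3) SD(3) e(1) assms(6)]
    by (simp add: cS q_def)
  have mZ2: "?m (\<lambda>G. (Z G)\<^sup>2) \<le> q\<^sup>2 * M\<^sup>2 * (1 + r)"
  proof -
    have "?m (\<lambda>G. (Z G)\<^sup>2) = (\<Sum>K\<in>S. \<Sum>K'\<in>S. ?m (\<lambda>G. ?I G K * ?I G K'))"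
      unfolding Z power2_eq_square sum_product subset_mean_sum ..
    also have "\<dots> = (\<Sum>K\<in>S. \<Sum>K'\<in>S. q\<^sup>2 * (1 / (1 - p)) ^ ((card (K \<inter> K') choose 2) - 1))"
      unfolding q_def
      using mean_indep_set_minus_pair(2)[OF assms(1) SD(1) SD(1) SD(2) SD(2) SD(3) SD(3) e(1) assms(6)]
      by (intro sum.cong refl) auto
    \<comment> \<open>Summed over \<open>K\<close>, the term \<open>M\<close> gives the square of
      the mean; the inner sum is the excess due to correlation.\<close>
    also have "\<dots> = (\<Sum>K\<in>S. q\<^sup>2 * (M + (\<Sum>K'\<in>S. (1 / (1 - p)) ^ ((card (K \<inter> K') choose 2) - 1) - 1)))"
      by (simp add: sum_distrib_left[symmetric] sum_subtractf cS)
    also have "\<dots> \<le> (\<Sum>K\<in>S. q\<^sup>2 * (M + M * r))"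
      unfolding S_def M_def r_def using fU assms
      by (intro sum_mono mult_left_mono add_left_mono overlap_sum_bound) auto
    also have "\<dots> = q\<^sup>2 * M\<^sup>2 * (1 + r)" by (simp add: cS power2_eq_square algebra_simps)
    finally show ?thesis .
  qed
  \<comment> \<open>As \<open>Z\<close> has mean M * q, a * Z has mean 1 / 2 and the quantity to
    bound is its variance.\<close>
  have a: "a = 1 / (2 * M * q)" by (simp add: a_def M_def q_def)
  have "?m (\<lambda>G. (a * Z G - 1 / 2)\<^sup>2) = ?m (\<lambda>G. a\<^sup>2 * (Z G)\<^sup>2 - a * Z G + 1 / 4)"
    by (intro subset_mean_cong) (simp add: power2_eq_square algebra_simps)
  also have "\<dots> = a\<^sup>2 * ?m (\<lambda>G. (Z G)\<^sup>2) - a * ?m Z + 1 / 4"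
    using fE by (simp add: subset_mean_add subset_mean_diff subset_mean_cmult)
  also have "\<dots> \<le> a\<^sup>2 * (q\<^sup>2 * M\<^sup>2 * (1 + r)) - a * (M * q) + 1 / 4"
    using mZ2 by (simp add: mZ mult_left_mono)
  also have "\<dots> = r / 4"
    using Mpos qpos by (simp add: a field_simps power2_eq_square)
  finally show ?thesis by (simp add: r_def)
qed

text \<open>Weak duality with uniform weights \<open>a\<close> that load a pair, ignoring its own
  status, to 1 / 2 on average against a capacity of 1. The main term is at least (m choose 2) / (4
  (k choose 2)), and the variance bound makes the expected violation at most (m choose 2) / (8 k^2),
  where m = card U.\<close>

lemma mean_cover_number_ge:
  fixes p :: real
  assumes "finite V" "U \<subseteq> V" "2 \<le> k" "k \<le> card U" "0 \<le> p" "p \<le> 1 / 2"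
    and r: "overlap_sum k (real k / card U) (1 / (1 - p)) \<le> 1 / (real k)\<^sup>2"
  shows "3 / 16 * (real (card U) / real k)\<^sup>2 \<le>
    subset_mean (nsets V 2) p (\<lambda>G. cover_number G U k)"
proof -
  let ?m = "subset_mean (nsets V 2) p"
  define m where "m = card U"
  define M where "M = real ((m - 2) choose (k - 2))"
  define q where "q = (1 - p) ^ ((k choose 2) - 1)"
  define a where "a = 1 / (2 * M * q)"
  define Z where "Z e G = real (card {K \<in> nsets U k. e \<subseteq> K \<and> indep_set (G - {e}) K})"
    for e :: "'a set" and G
  have fU: "finite U" using assms finite_subset by blast
  have fU2: "finite (nsets U 2)" "finite (nsets U k)" using fU by (auto simp: finite_imp_finite_nsets)
  have Mpos: "0 < M" using assms by (simp add: M_def m_def)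
  have qpos: "0 < q" using assms by (simp add: q_def)
  have apos: "0 < a" using Mpos qpos by (simp add: a_def)
  have mpos: "0 < real m" "2 \<le> m" using assms by (auto simp: m_def)
  have main: "a * card {K \<in> nsets U k. indep_set G K} - (\<Sum>e\<in>nsets U 2. (a * Z e G - 1 / 2)\<^sup>2 / 2)
      \<le> cover_number G U k" for G
  proof -
    have "max 0 (a * card {K \<in> nsets U k. e \<subseteq> K \<and> indep_set G K} - 1) \<le> (a * Z e G - 1 / 2)\<^sup>2 / 2" for e
    proof -
      have "card {K \<in> nsets U k. e \<subseteq> K \<and> indep_set G K} \<le>
          card {K \<in> nsets U k. e \<subseteq> K \<and> indep_set (G - {e}) K}"
        using fU2 by (intro card_mono) (auto simp: indep_set_def)
      then have "a * card {K \<in> nsets U k. e \<subseteq> K \<and> indep_set G K} \<le> a * Z e G"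
        unfolding Z_def using apos by (intro mult_left_mono) auto
      \<comment> \<open>For z = a * Z the difference of the two sides is (z - 3 / 2)^2 / 2.\<close>
      moreover have "a * Z e G - 1 \<le> (a * Z e G - 1 / 2)\<^sup>2 / 2"
        using zero_le_power2[of "a * Z e G - 3 / 2"] by (simp add: power2_eq_square algebra_simps)
      moreover have "0 \<le> (a * Z e G - 1 / 2)\<^sup>2 / 2" by simp
      ultimately show ?thesis by linarith
    qed
    then have "(\<Sum>e\<in>nsets U 2. max 0 (a * card {K \<in> nsets U k. e \<subseteq> K \<and> indep_set G K} - 1)) \<le>
        (\<Sum>e\<in>nsets U 2. (a * Z e G - 1 / 2)\<^sup>2 / 2)"
      by (intro sum_mono)
    then show ?thesis using cover_number_ge_packing[OF fU assms(3), of a G] apos by linarith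
  qed
  have mcard: "?m (\<lambda>G. real (card {K \<in> nsets U k. indep_set G K})) =
      real (m choose k) * (1 - p) ^ (k choose 2)"
  proof -
    have "real (card {K \<in> nsets U k. indep_set G K}) = (\<Sum>K\<in>nsets U k. of_bool (indep_set G K))" for G
      using fU2 by (simp add: sum_of_bool_eq Collect_conj_eq)
    then have "?m (\<lambda>G. real (card {K \<in> nsets U k. indep_set G K})) =
        (\<Sum>K\<in>nsets U k. ?m (\<lambda>G. of_bool (indep_set G K)))"
      by (simp add: subset_mean_sum)
    also have "\<dots> = (\<Sum>K\<in>nsets U k. (1 - p) ^ (k choose 2))"
    proof (rule sum.cong[OF refl])
      fix K assume "K \<in> nsets U k"
      then have "K \<subseteq> V" "card K = k" using assms(2) by (auto simp: nsets_def)
      then show "?m (\<lambda>G. of_bool (indep_set G K)) = (1 - p) ^ (k choose 2)"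
        using mean_indep_set[OF assms(1)] by metis
    qed
    finally show ?thesis using fU by (simp add: card_nsets m_def)
  qed
  have ident: "a * (real (m choose k) * (1 - p) ^ (k choose 2)) =
      (1 - p) * real (m choose 2) / (2 * real (k choose 2))"
  proof -
    have pq: "(1 - p) ^ (k choose 2) = q * (1 - p)"
      using assms(3) power_minus_mult[of "k choose 2" "1 - p"] by (simp add: q_def)
    have "real (m choose k) * real (k choose 2) = real (m choose 2) * M"
    proof -
      have "(m choose k) * (k choose 2) = (m choose 2) * ((m - 2) choose (k - 2))"
        using assms(3,4) by (intro choose_mult) (auto simp: m_def)
      then show ?thesis unfolding M_def by (metis of_nat_mult)
    qed
    moreover have "0 < real (k choose 2)" using assms(3) by simp
    ultimately have "real (m choose k) / M = real (m choose 2) / real (k choose 2)"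
      using Mpos by (simp add: frac_eq_eq)
    moreover have "a * (real (m choose k) * (q * (1 - p))) = (1 - p) * (real (m choose k) / M) / 2"
      using Mpos qpos by (simp add: a_def mult.commute)
    ultimately show ?thesis unfolding pq by simp
  qed
  have ch2: "real (x choose 2) = real x * (real x - 1) / 2" for x
    using choose_two[of x] by (cases x) (auto simp: real_of_nat_div field_simps)
  have kpos: "0 < real k * (real k - 1)" using assms(3) by simp
  \<comment> \<open>1 / (4 (k choose 2)) is 4 / (8 k (k - 1)), of which the violation takes at most
    one quarter. Then m (m - 1) / (k (k - 1)) \<ge> (m / k)^2.\<close>
  have "3 / 16 * (real m / real k)\<^sup>2 \<le> real (m choose 2) * (1 / (4 * real (k choose 2)) - 1 / (8 * (real k)\<^sup>2))"
  proof -
    have km: "real k \<le> real m" using assms by (simp add: m_def)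
    have "1 / (4 * real (k choose 2)) - 1 / (8 * (real k)\<^sup>2) \<ge> 3 / (8 * (real k * (real k - 1)))"
    proof -
      have "real k * (real k - 1) \<le> (real k)\<^sup>2" by (simp add: power2_eq_square algebra_simps)
      then have "1 / (8 * (real k)\<^sup>2) \<le> 1 / (8 * (real k * (real k - 1)))"
        using kpos by (intro frac_le) auto
      moreover have "1 / (4 * (w / 2)) = 3 / (8 * w) + 1 / (8 * w)" for w :: real
        by (simp add: field_simps)
      from this[of "real k * (real k - 1)"]
      have "1 / (4 * real (k choose 2)) = 3 / (8 * (real k * (real k - 1))) + 1 / (8 * (real k * (real k - 1)))"
        unfolding ch2 .
      ultimately show ?thesis by linarith
    qed
    then have "real (m choose 2) * (3 / (8 * (real k * (real k - 1)))) \<le>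
        real (m choose 2) * (1 / (4 * real (k choose 2)) - 1 / (8 * (real k)\<^sup>2))"
      by (intro mult_left_mono) auto
    moreover have "3 / 16 * (real m / real k)\<^sup>2 \<le> real (m choose 2) * (3 / (8 * (real k * (real k - 1))))"
    proof -
      have "real m * (real k - 1) \<le> (real m - 1) * real k" using km by (simp add: algebra_simps)
      then have "(real m * real k) * (real m * (real k - 1)) \<le> (real m * real k) * ((real m - 1) * real k)"
        using mpos by (intro mult_left_mono) auto
      then have "(real m)\<^sup>2 * (real k * (real k - 1)) \<le> real m * (real m - 1) * (real k)\<^sup>2"
        by (simp add: power2_eq_square algebra_simps)
      then have "(real m)\<^sup>2 / (real k)\<^sup>2 \<le> real m * (real m - 1) / (real k * (real k - 1))"
        using kpos assms(3) by (simp add: divide_le_eq pos_le_divide_eq)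
      then have "3 / 16 * (real m / real k)\<^sup>2 \<le> 3 / 16 * (real m * (real m - 1) / (real k * (real k - 1)))"
        unfolding power_divide by (rule mult_left_mono) simp
      also have "\<dots> = real (m choose 2) * (3 / (8 * (real k * (real k - 1))))"
        by (simp add: ch2 ac_simps)
      finally show ?thesis .
    qed
    ultimately show ?thesis by linarith
  qed
  also have "\<dots> \<le> a * (real (m choose k) * (1 - p) ^ (k choose 2)) -
      real (m choose 2) * (overlap_sum k (real k / m) (1 / (1 - p)) / 8)"
  proof -
    have "1 / (4 * real (k choose 2)) \<le> (1 - p) / (2 * real (k choose 2))"
      using divide_right_mono[of "1 / 2" "1 - p" "2 * real (k choose 2)"] assms(6) by simp
    moreover have "overlap_sum k (real k / m) (1 / (1 - p)) / 8 \<le> 1 / (8 * (real k)\<^sup>2)"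
      using r by (simp add: m_def)
    ultimately have "real (m choose 2) * (1 / (4 * real (k choose 2)) - 1 / (8 * (real k)\<^sup>2)) \<le>
        real (m choose 2) * ((1 - p) / (2 * real (k choose 2)) - overlap_sum k (real k / m) (1 / (1 - p)) / 8)"
      by (intro mult_left_mono) auto
    then show ?thesis unfolding ident by (simp add: algebra_simps)
  qed
  also have "\<dots> \<le> a * (real (m choose k) * (1 - p) ^ (k choose 2)) -
      (\<Sum>e\<in>nsets U 2. ?m (\<lambda>G. (a * Z e G - 1 / 2)\<^sup>2) / 2)"
  proof -
    have "(\<Sum>e\<in>nsets U 2. ?m (\<lambda>G. (a * Z e G - 1 / 2)\<^sup>2) / 2) \<le>
        (\<Sum>e\<in>nsets U 2. overlap_sum k (real k / m) (1 / (1 - p)) / 4 / 2)"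
      unfolding a_def M_def q_def Z_def m_def
      using assms(1-6) by (intro sum_mono divide_right_mono mean_square_deviation) auto
    also have "\<dots> = real (m choose 2) * (overlap_sum k (real k / m) (1 / (1 - p)) / 8)"
      using fU by (simp add: card_nsets m_def)
    finally show ?thesis by linarith
  qed
  also have "\<dots> = ?m (\<lambda>G. a * card {K \<in> nsets U k. indep_set G K} -
      (\<Sum>e\<in>nsets U 2. (a * Z e G - 1 / 2)\<^sup>2 / 2))"
  proof -
    have half: "?m (\<lambda>G. F G / 2) = ?m F / 2" for F
      using subset_mean_cmult[of "nsets V 2" p "1 / 2" F] by simp
    show ?thesis by (simp add: half subset_mean_diff subset_mean_cmult subset_mean_sum mcard)
  qed
  also have "\<dots> \<le> ?m (\<lambda>G. cover_number G U k)"
    using main assms(5,6) by (intro subset_mean_mono) auto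
  finally show ?thesis by (simp add: m_def)
qed

section \<open>Tail bounds and the deterministic colouring\<close>

text \<open>If every independent \<open>k\<close>-set of \<open>G\<close> contained many edges of \<open>H\<close>, then the rescaled indicator
  function of \<open>H\<close> would be a fractional cover that is too cheap.\<close>
lemma exists_indep_set_few_edges:
  assumes "finite V" "simple_graph V H" "U \<subseteq> V" "U \<noteq> {}" "2 \<le> k"
    and cover: "(real (card U) / real k)\<^sup>2 / 8 \<le> cover_number G U k"
  shows "\<exists>K\<in>nsets U k. indep_set G K \<and>
    real (card (H \<inter> nsets K 2)) * (real (card U) / real k)\<^sup>2 \<le> 4 * (card U * max_degree V H)"
proof -
  define \<K> where "\<K> = {K \<in> nsets U k. indep_set G K}"
  have fU: "finite U" using assms finite_subset by blast
  have f\<K>: "finite \<K>" using fU by (simp add: \<K>_def finite_imp_finite_nsets)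
  have pos: "0 < (real (card U) / real k)\<^sup>2" using assms fU by (simp add: card_gt_0_iff)
  \<comment> \<open>Otherwise the zero function would be a cover, forcing the cover number to be at
    most 0.\<close>
  have "\<K> \<noteq> {}"
  proof
    assume "\<K> = {}"
    then have "(\<lambda>_. 0) \<in> fractional_covers G U k" by (auto simp: fractional_covers_def \<K>_def)
    then show False using cover_number_le[of "\<lambda>_. 0" G U k] cover pos by simp
  qed
  then obtain K where K: "K \<in> \<K>"
    "\<And>K'. K' \<in> \<K> \<Longrightarrow> card (H \<inter> nsets K 2) \<le> card (H \<inter> nsets K' 2)"
    using arg_min_if_finite[OF f\<K>, of "\<lambda>K. card (H \<inter> nsets K 2)"] by (metis not_le)
  define h where "h = card (H \<inter> nsets K 2)"
  have "real h * (real (card U) / real k)\<^sup>2 \<le> 4 * (card U * max_degree V H)"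
  proof (cases "h = 0")
    case False
    have sum_y: "(\<Sum>e\<in>A. of_bool (e \<in> H) / real h) = card (H \<inter> A) / h" if "finite A" for A
      using that by (simp add: sum_of_bool_eq Int_commute flip: sum_divide_distrib)
    \<comment> \<open>By minimality of \<open>h\<close>, every independent k-set carries at least
      \<open>h\<close> edges of \<open>H\<close> and so receives weight at least 1.\<close>
    have "(\<lambda>e. of_bool (e \<in> H) / h) \<in> fractional_covers G U k"
      unfolding fractional_covers_def
    proof (intro CollectI conjI allI ballI impI)
      fix K' assume K': "K' \<in> nsets U k" "indep_set G K'"
      then have "h \<le> card (H \<inter> nsets K' 2)" using K(2)[of K'] by (simp add: \<K>_def h_def)
      moreover have "finite (nsets K' 2)" using K' by (auto simp: nsets_def)
      ultimately show "1 \<le> (\<Sum>e\<in>nsets K' 2. of_bool (e \<in> H) / real h)"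
        using False by (simp add: sum_y)
    qed (use False in auto)
    from cover_number_le[OF this] cover
    have "(real (card U) / real k)\<^sup>2 / 8 \<le> card (H \<inter> nsets U 2) / h"
      unfolding sum_y[OF finite_imp_finite_nsets[OF fU]] by linarith
    then have "(real (card U) / real k)\<^sup>2 / 8 * h \<le> card (H \<inter> nsets U 2)"
      using False by (simp add: pos_le_divide_eq)
    then have "real h * (real (card U) / real k)\<^sup>2 \<le> 4 * (2 * real (card (H \<inter> nsets U 2)))"
      by (simp add: mult.commute)
    also have "\<dots> \<le> 4 * (card U * max_degree V H)"
      using of_nat_mono[OF card_edges_le_max_degree[OF assms(1-3)], where 'a = real] by simp
    finally show ?thesis .
  qed simp
  then show ?thesis using K(1) by (auto simp: h_def \<K>_def)
qed

text \<open>Inside the k-set with few edges of \<open>H\<close> the average degree is at most d = 8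
  \<Delta> k / m, where \<Delta> is the maximum degree of \<open>H\<close> and m = card U. Turan
  then gives k / (1 + d) = 1 / (1 / k + 8 \<Delta> / m) vertices.\<close>

lemma exists_large_indep_set_Un:
  assumes "finite V" "simple_graph V H" "U \<subseteq> V" "U \<noteq> {}" "2 \<le> k"
    and cover: "(real (card U) / real k)\<^sup>2 / 8 \<le> cover_number G U k"
  shows "\<exists>I\<subseteq>U. indep_set (G \<union> H) I \<and>
    1 \<le> card I * (1 / real k + 8 * real (max_degree V H) / card U)"
proof -
  obtain K where K: "K \<in> nsets U k" "indep_set G K"
    "real (card (H \<inter> nsets K 2)) * (real (card U) / real k)\<^sup>2 \<le> 4 * (card U * max_degree V H)"
    using exists_indep_set_few_edges[OF assms] by blast
  have K': "finite K" "card K = k" "K \<subseteq> U" using K(1) by (auto simp: nsets_def)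
  have mpos: "0 < real (card U)" using assms finite_subset by (metis card_gt_0_iff of_nat_0_less_iff)
  define d where "d = 8 * real (max_degree V H) * k / card U"
  have kpos: "0 < real k" using assms by simp
  have dnn: "0 \<le> d" by (simp add: d_def)
  have "2 * real (card (H \<inter> nsets K 2)) \<le> d * k"
  proof -
    have "x * (m / c)\<^sup>2 \<le> 4 * (m * D) \<Longrightarrow> 2 * x \<le> 8 * D * c / m * c"
      if "0 < m" "0 < c" for x m c D :: real
    proof -
      assume *: "x * (m / c)\<^sup>2 \<le> 4 * (m * D)"
      have "x = x * (m / c)\<^sup>2 * (c / m)\<^sup>2" using that by (simp add: power_divide)
      also have "\<dots> \<le> 4 * (m * D) * (c / m)\<^sup>2" using * by (intro mult_right_mono) auto
      also have "\<dots> = 4 * D * c / m * c" using that by (simp add: power_divide power2_eq_square)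
      finally show ?thesis by simp
    qed
    from this[OF mpos kpos K(3)[unfolded of_nat_mult of_nat_numeral]] show ?thesis by (simp add: d_def)
  qed
  then obtain I where I: "I \<subseteq> K" "indep_set H I" "k / (1 + d) \<le> card I"
    using turan_independent[of K H d] K' assms by fastforce
  have "1 \<le> card I * (1 / real k + 8 * real (max_degree V H) / card U)"
  proof -
    have "real k \<le> card I * (1 + d)" using I(3) dnn by (simp add: divide_le_eq)
    then have "1 \<le> card I * (1 + d) / k" using kpos by (simp add: le_divide_eq)
    also have "\<dots> = card I * (1 / real k + 8 * real (max_degree V H) / card U)"
      using kpos mpos by (simp add: d_def field_simps)
    finally show ?thesis .
  qed
  moreover have "indep_set (G \<union> H) I"
    using I K(2) indep_set_mono[of G K G I] by (simp add: indep_set_Un)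
  ultimately show ?thesis using I(1) K'(3) by (intro exI[of _ I]) auto
qed

text \<open>The hypotheses on \<open>G\<close> do not involve \<open>H\<close>, so one good
  \<open>G\<close> serves all \<open>H\<close> at once. Extraction with a = 8 \<Delta> runs while at
  least \<open>m0\<close> vertices are left; below that, every subset has a vertex of degree at most
  2 D + \<Delta> in the union.\<close>

lemma chromatic_number_Un_le:
  fixes m0 D :: real
  assumes V: "finite V" and G: "G \<subseteq> nsets V 2" and H: "simple_graph V H"
    and k: "2 \<le> k" and m0: "0 < m0" "m0 \<le> card V" and D: "0 \<le> D"
    and A: "\<And>U. U \<subseteq> V \<Longrightarrow> m0 \<le> card U \<Longrightarrow> (real (card U) / real k)\<^sup>2 / 8 \<le> cover_number G U k"
    and B: "\<And>S. S \<subseteq> V \<Longrightarrow> S \<noteq> {} \<Longrightarrow> card S \<le> m0 \<Longrightarrow> card (G \<inter> nsets S 2) < D * card S"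
  shows "real (chromatic_number V (G \<union> H)) \<le> 2 * D + max_degree V H + 2 + card V / real k
    + 8 * real (max_degree V H) * ln (card V / m0)"
proof -
  define \<Delta> where "\<Delta> = max_degree V H"
  have loop: "{v} \<notin> G \<union> H" for v
    using G H by (auto simp: simple_graph_def nsets_def)
  have "\<exists>j c. proper_colouring V (G \<union> H) j c \<and>
    real j \<le> (2 * D + \<Delta> + 1) + (if card V < m0 then 0 else 1 + card V / real k + (8 * \<Delta>) * ln (card V / m0))"
  proof (rule colourable_by_extraction[OF V loop m0(1)])
    fix S assume S: "S \<subseteq> V" "card S < m0"
    have fS: "finite S" using S V finite_subset by blast
    have "\<exists>c. proper_colouring S (G \<union> H) (Suc (nat \<lfloor>2 * D\<rfloor> + \<Delta>)) c"
    proof (rule colourable_degenerate[OF fS loop])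
      fix T assume T: "T \<subseteq> S" "T \<noteq> {}"
      have fT: "finite T" using T fS finite_subset by blast
      have "card T \<le> card S" using T fS card_mono by blast
      then have "real (card (G \<inter> nsets T 2)) < D * card T" using B[of T] T S by auto
      then obtain v where v: "v \<in> T" "real (degree_in G T v) \<le> 2 * D"
        using exists_small_degree[OF fT T(2), of G "2 * D"] by auto
      then have "degree_in G T v \<le> nat \<lfloor>2 * D\<rfloor>" using D by (simp add: le_nat_floor)
      moreover have "degree_in H T v \<le> \<Delta>"
        unfolding \<Delta>_def using degree_in_le_max_degree[OF V H] T S v by blast
      ultimately have "degree_in (G \<union> H) T v \<le> nat \<lfloor>2 * D\<rfloor> + \<Delta>"
        using degree_in_Un[OF fT, of G H v] by linarith
      then show "\<exists>v\<in>T. degree_in (G \<union> H) T v \<le> nat \<lfloor>2 * D\<rfloor> + \<Delta>" using v by blast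
    qed
    moreover have "real (Suc (nat \<lfloor>2 * D\<rfloor> + \<Delta>)) \<le> 2 * D + \<Delta> + 1" using D by simp
    ultimately show "\<exists>j c. proper_colouring S (G \<union> H) j c \<and> real j \<le> 2 * D + \<Delta> + 1" by blast
  next
    fix S assume S: "S \<subseteq> V" "m0 \<le> card S"
    then have "S \<noteq> {}" using m0 by auto
    then show "\<exists>I\<subseteq>S. indep_set (G \<union> H) I \<and> 1 \<le> card I * (1 / real k + (8 * \<Delta>) / card S)"
      using exists_large_indep_set_Un[OF V H S(1) _ k A[OF S]] by (simp add: \<Delta>_def)
  qed (use k D in auto)
  then obtain j c where "proper_colouring V (G \<union> H) j c"
    "real j \<le> (2 * D + \<Delta> + 1) + (1 + card V / real k + (8 * \<Delta>) * ln (card V / m0))"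
    using m0 by (auto split: if_splits)
  then show ?thesis using chromatic_number_le[of V "G \<union> H" j c] by (simp add: \<Delta>_def)
qed

text \<open>The mean has constant 3 / 16 and the threshold 1 / 8, which leaves a gap of 1 /
  16.\<close>

lemma cover_number_tail:
  fixes p lam :: real
  assumes "finite V" "U \<subseteq> V" "2 \<le> k" "k \<le> card U" "0 \<le> p" "p \<le> 1 / 2" "0 \<le> lam" "lam \<le> 1"
    and "overlap_sum k (real k / card U) (1 / (1 - p)) \<le> 1 / (real k)\<^sup>2"
  shows "subset_mean (nsets V 2) p (\<lambda>G. of_bool (cover_number G U k < (real (card U) / real k)\<^sup>2 / 8)) \<le>
    exp (- lam * ((real (card U) / real k)\<^sup>2 / 16) + lam\<^sup>2 * p * (card V choose 2))"
proof -
  have fU: "finite U" using assms finite_subset by blast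
  have "subset_mean (nsets V 2) p (\<lambda>G. of_bool (cover_number G U k < (real (card U) / real k)\<^sup>2 / 8)) \<le>
    exp (- lam * ((real (card U) / real k)\<^sup>2 / 16) + lam\<^sup>2 * p * card (nsets V 2))"
    using assms mean_cover_number_ge[OF assms(1-6,9)] fU
    by (intro subset_mean_lower_tail)
      (auto simp: finite_imp_finite_nsets cover_number_insert_le cover_number_le_insert)
  then show ?thesis using assms by (simp add: card_nsets)
qed

text \<open>With s = card S: if s \<le> 2 D there are fewer than D * s pairs. Otherwise Markov for 2
  ^ edges gives the exponent - D s (ln 2 - 1 / 2) \<le> - D s / 6 \<le> - D^2 / 3, by ln 2 \<ge> 2 /
  3.\<close>

lemma edge_count_tail:
  fixes p D :: real
  assumes "finite V" "S \<subseteq> V" "S \<noteq> {}" "0 \<le> p" "p \<le> 1" "p * card S \<le> D" "0 \<le> D"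
  shows "subset_mean (nsets V 2) p (\<lambda>G. of_bool (D * card S \<le> card (G \<inter> nsets S 2))) \<le> exp (- (D\<^sup>2 / 3))"
proof -
  define s where "s = real (card S)"
  have fS: "finite S" using assms finite_subset by blast
  have s1: "1 \<le> s" using assms fS by (simp add: s_def Suc_le_eq card_gt_0_iff)
  have ch2: "real (card S choose 2) = s * (s - 1) / 2"
    using choose_two[of "card S"] by (cases "card S") (auto simp: s_def real_of_nat_div field_simps)
  have sub: "nsets S 2 \<subseteq> nsets V 2" using assms by (intro nsets_mono)
  have fE: "finite (nsets V 2)" "finite (nsets S 2)" using assms fS by (auto simp: finite_imp_finite_nsets)
  show ?thesis
  proof (cases "s \<le> 2 * D")
    case True
    have "\<not> D * s \<le> card (G \<inter> nsets S 2)" for G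
    proof -
      have "real (card (G \<inter> nsets S 2)) \<le> card S choose 2"
        using card_mono[OF fE(2), of "G \<inter> nsets S 2"] fS by (simp add: card_nsets)
      also have "\<dots> < s * s / 2" using s1 by (simp add: ch2 algebra_simps)
      also have "\<dots> \<le> D * s" using True s1 mult_right_mono[OF True, of s] by simp
      finally show ?thesis by simp
    qed
    then show ?thesis using fE by (simp add: s_def)
  next
    case False
    have "subset_mean (nsets V 2) p (\<lambda>G. of_bool (D * card S \<le> card (G \<inter> nsets S 2))) \<le>
        subset_mean (nsets V 2) p (\<lambda>G. exp (- (D * s * ln 2)) * 2 ^ card (G \<inter> nsets S 2))"
    proof (intro subset_mean_mono assms)
      fix G :: "'a set set"
      have "1 \<le> exp (- (D * s * ln 2)) * 2 ^ card (G \<inter> nsets S 2)" if "D * s \<le> card (G \<inter> nsets S 2)"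
      proof -
        have "0 \<le> - (D * s * ln 2) + card (G \<inter> nsets S 2) * ln 2"
          using mult_right_mono[OF that, of "ln 2"] by simp
        then have "1 \<le> exp (- (D * s * ln 2) + card (G \<inter> nsets S 2) * ln 2)" by simp
        also have "\<dots> = exp (- (D * s * ln 2)) * 2 ^ card (G \<inter> nsets S 2)"
          by (simp only: exp_add exp_of_nat_mult) simp
        finally show ?thesis .
      qed
      then show "of_bool (D * card S \<le> card (G \<inter> nsets S 2)) \<le>
          exp (- (D * s * ln 2)) * 2 ^ card (G \<inter> nsets S 2)"
        by (auto simp: s_def)
    qed
    also have "\<dots> = exp (- (D * s * ln 2)) * (1 + p) ^ (card S choose 2)"
      using fE sub fS by (simp add: subset_mean_cmult subset_mean_power2_card card_nsets)
    also have "\<dots> \<le> exp (- (D * s * ln 2)) * exp (p * (card S choose 2))"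
      using exp_ge_add_one_self[of p] assms
      by (intro mult_left_mono) (auto simp: mult.commute[of p] exp_of_nat_mult intro!: power_mono)
    also have "\<dots> = exp (- (D * s * ln 2) + p * (card S choose 2))" by (simp only: exp_add)
    also have "\<dots> \<le> exp (- (D\<^sup>2 / 3))"
    proof -
      have "p * (card S choose 2) \<le> p * (s * s / 2)"
        using assms s1 by (intro mult_left_mono) (auto simp: ch2 algebra_simps)
      also have "\<dots> \<le> D * s / 2"
        using mult_right_mono[OF assms(6), of s] s1 by (simp add: s_def algebra_simps)
      finally have 1: "p * (card S choose 2) \<le> D * s / 2" .
      have "D * s * (2 / 3) \<le> D * s * ln 2"
        using ln2_ge_two_thirds assms s1 by (intro mult_left_mono) auto
      moreover have "D * (2 * D) \<le> D * s" using False assms by (intro mult_left_mono) auto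
      ultimately show ?thesis using 1 by (simp add: power2_eq_square)
    qed
    finally show ?thesis .
  qed
qed

lemma subset_mean_union_bound:
  fixes p c :: real
  assumes "finite E" "finite I" "0 \<le> p" "p \<le> 1"
    and "\<And>i. i \<in> I \<Longrightarrow> subset_mean E p (\<lambda>A. of_bool (\<not> P i A)) \<le> c"
    and "\<And>A. A \<subseteq> E \<Longrightarrow> (\<And>i. i \<in> I \<Longrightarrow> P i A) \<Longrightarrow> Q A"
  shows "1 - card I * c \<le> subset_mean E p (\<lambda>A. of_bool (Q A))"
proof -
  have "1 - card I * c \<le> 1 - (\<Sum>i\<in>I. subset_mean E p (\<lambda>A. of_bool (\<not> P i A)))"
    using sum_mono[of I "\<lambda>i. subset_mean E p (\<lambda>A. of_bool (\<not> P i A))" "\<lambda>_. c"] assms(5) by simp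
  also have "\<dots> = subset_mean E p (\<lambda>A. 1 - (\<Sum>i\<in>I. of_bool (\<not> P i A)))"
    using assms(1) by (simp add: subset_mean_diff subset_mean_sum)
  also have "\<dots> \<le> subset_mean E p (\<lambda>A. of_bool (Q A))"
  proof (intro subset_mean_mono assms(3,4))
    fix A assume A: "A \<subseteq> E"
    have nn: "0 \<le> (\<Sum>i\<in>I. of_bool (\<not> P i A) :: real)" by (intro sum_nonneg) auto
    show "1 - (\<Sum>i\<in>I. of_bool (\<not> P i A)) \<le> (of_bool (Q A) :: real)"
    proof (cases "\<forall>i\<in>I. P i A")
      case True
      then show ?thesis using assms(6)[OF A] nn by auto
    next
      case False
      then obtain i where "i \<in> I" "\<not> P i A" by blast
      then have "1 \<le> (\<Sum>i\<in>I. of_bool (\<not> P i A) :: real)"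
        using member_le_sum[of i I "\<lambda>i. of_bool (\<not> P i A) :: real"] assms(2) by auto
      moreover have "0 \<le> (of_bool (Q A) :: real)" by simp
      ultimately show ?thesis by linarith
    qed
  qed
  finally show ?thesis .
qed

section \<open>Asymptotic estimates\<close>

lemma sum_half_powers_le: "(\<Sum>j=1..N. (1 / 2 :: real) ^ j) \<le> 1"
proof -
  have "(\<Sum>j=1..N. (1 / 2 :: real) ^ j) = 1 - (1 / 2) ^ N"
    by (induction N) (auto simp: field_simps)
  then show ?thesis by simp
qed

lemma overlap_exponent: "2 * (((j + 2) choose 2) - 1) = j * (j + 3)"
proof -
  have "2 * ((j + 2) choose 2) = (j + 2) * (j + 1)"
    by (induction j) (auto simp: numeral_2_eq_2)
  then show ?thesis by (simp add: diff_mult_distrib2 algebra_simps)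
qed

lemma overlap_sum_mono:
  assumes "0 \<le> \<rho>" "\<rho> \<le> \<rho>'" "1 \<le> b"
  shows "overlap_sum k \<rho> b \<le> overlap_sum k \<rho>' b"
  unfolding overlap_sum_def using assms
  by (intro sum_mono mult_right_mono mult_left_mono power_mono) auto

text \<open>The four terms come from \<open>j = 1\<close>, \<open>j = 2\<close>, \<open>3 \<le> j \<le> k / 36\<close> and \<open>j > k / 36\<close>. Only for
  \<open>j = 1\<close> is it necessary to exploit that \<open>b\<^sup>2 - 1\<close> is of order \<open>p\<close>; this is what allows \<open>p\<close> to go
  down to about \<open>n\<close> to the power \<open>- 1 / 3\<close>.\<close>
lemma overlap_sum_le:
  fixes \<rho> b x B :: real
  assumes rho: "0 \<le> \<rho>" and b: "1 \<le> b"
    and B: "\<And>j. 36 * j \<le> k \<Longrightarrow> b ^ j \<le> B" and x: "k * \<rho> * B \<le> x" "x \<le> 1 / 2"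
    and y: "2 ^ 36 * \<rho> * sqrt b ^ (k + 1) \<le> exp (- 36) / 2"
  shows "overlap_sum k \<rho> b \<le> k * \<rho> * (b\<^sup>2 - 1) + (k * \<rho>)\<^sup>2 * b ^ 5 + 8 * x ^ 3 + exp (- real k)"
proof -
  have Bpos: "0 \<le> B" using B[of 0] by simp
  have kr: "0 \<le> k * \<rho>" using rho by simp
  have xpos: "0 \<le> x" using x(1) mult_nonneg_nonneg[OF kr Bpos] by linarith
  define e where "e j = ((j + 2) choose 2) - 1" for j
  have e2: "2 * e j = j * (j + 3)" for j unfolding e_def by (rule overlap_exponent)
  define A1 where "A1 = k * \<rho> * (b\<^sup>2 - 1)"
  define A2 where "A2 = (k * \<rho>)\<^sup>2 * b ^ 5"
  have A: "0 \<le> A1" "0 \<le> A2" using kr b by (auto simp: A1_def A2_def)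
  have bin: "real ((k - 2) choose j) * \<rho> ^ j \<le> (k * \<rho>) ^ j" for j
  proof -
    have "(k - 2) choose j \<le> (k - 2) ^ j"
      by (cases "j \<le> k - 2") (auto intro: binomial_le_pow simp: binomial_eq_0)
    also have "\<dots> \<le> k ^ j" by (intro power_mono) auto
    finally have "real ((k - 2) choose j) \<le> real k ^ j" by (metis of_nat_mono of_nat_power)
    then show ?thesis using rho by (simp add: power_mult_distrib mult_right_mono)
  qed
  \<comment> \<open>The factor (1 / 2) ^ j lets the bounds for the two ranges j \<ge> 3 be summed
    over \<open>j\<close> without loss.\<close>
  have term_le: "real ((k - 2) choose j) * \<rho> ^ j * (b ^ e j - 1) \<le>
      (if j = 1 then A1 else 0) + (if j = 2 then A2 else 0) + (8 * x ^ 3 + exp (- real k)) * (1 / 2) ^ j"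
    if j: "j \<in> {1..k - 2}" for j
  proof -
    have be: "0 \<le> b ^ e j - 1" "b ^ e j - 1 \<le> b ^ e j" using b by auto
    have rest: "0 \<le> (8 * x ^ 3 + exp (- real k)) * (1 / 2) ^ j" using xpos by simp
    consider "j = 1" | "j = 2" | "3 \<le> j" "36 * j \<le> k" | "3 \<le> j" "k < 36 * j" using j by fastforce
    then show ?thesis
    proof cases
      case 1
      then have "e j = 2" using e2[of j] by simp
      then have "real ((k - 2) choose j) * \<rho> ^ j * (b ^ e j - 1) \<le> A1"
        using mult_right_mono[OF bin[of j] be(1)] 1 by (simp add: A1_def)
      moreover have "(if j = 1 then A1 else 0) = A1" "(if j = 2 then A2 else 0) = 0" using 1 by auto
      ultimately show ?thesis using rest by linarith
    next
      case 2
      then have "e j = 5" using e2[of j] by simp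
      then have "real ((k - 2) choose j) * \<rho> ^ j * (b ^ e j - 1) \<le> (k * \<rho>) ^ j * b ^ 5"
        using mult_mono[OF bin[of j] be(2)] be kr by simp
      moreover have "(k * \<rho>) ^ j * b ^ 5 = A2" using 2 by (simp add: A2_def)
      moreover have "(if j = 1 then A1 else 0) = 0" "(if j = 2 then A2 else 0) = A2" using 2 by auto
      ultimately show ?thesis using rest by linarith
    next
      case 3
      \<comment> \<open>For j \<ge> 3 the exponent j (j + 3) / 2 is at most j^2, so the term is at
        most x ^ j. The 8 makes up for the three factors 1 / 2 lost to x ^ 3.\<close>
      have "2 * e j \<le> 2 * (j * j)" unfolding e2 using 3(1) by simp
      then have "b ^ e j \<le> b ^ (j * j)" using b by (intro power_increasing) auto
      also have "\<dots> = (b ^ j) ^ j" by (simp add: power_mult)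
      also have "\<dots> \<le> B ^ j" using B[OF 3(2)] b by (intro power_mono) auto
      finally have "b ^ e j - 1 \<le> B ^ j" using be by linarith
      then have "real ((k - 2) choose j) * \<rho> ^ j * (b ^ e j - 1) \<le> (k * \<rho>) ^ j * B ^ j"
        using mult_mono[OF bin[of j], of "b ^ e j - 1" "B ^ j"] be kr by simp
      also have "\<dots> = (k * \<rho> * B) ^ j" by (simp add: power_mult_distrib)
      also have "\<dots> \<le> x ^ j" using x kr Bpos by (intro power_mono) auto
      also have "\<dots> = x ^ 3 * x ^ (j - 3)" using 3 by (simp flip: power_add)
      also have "\<dots> \<le> x ^ 3 * (1 / 2) ^ (j - 3)"
        using x xpos by (intro mult_left_mono power_mono) auto
      also have "\<dots> = 8 * x ^ 3 * (1 / 2) ^ j"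
        using 3(1) power_add[of "1 / 2 :: real" "j - 3" 3] by (simp add: power3_eq_cube)
      also have "\<dots> \<le> (8 * x ^ 3 + exp (- real k)) * (1 / 2) ^ j" by (simp add: algebra_simps)
      finally have "real ((k - 2) choose j) * \<rho> ^ j * (b ^ e j - 1) \<le>
        (8 * x ^ 3 + exp (- real k)) * (1 / 2) ^ j" .
      moreover have "(if j = 1 then A1 else 0) = 0" "(if j = 2 then A2 else 0) = 0" using 3 by auto
      ultimately show ?thesis by linarith
    next
      case 4
      \<comment> \<open>As k < 36 j, the crude bound 2 ^ k costs at most 2 ^ 36 per unit of
        \<open>j\<close>, and a gain of exp (- 36) per unit yields exp (- k).\<close>
      have "real ((k - 2) choose j) \<le> (2 ^ 36) ^ j"
      proof -
        have "(k - 2) choose j \<le> 2 ^ (k - 2)" by (rule binomial_le_pow2)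
        also have "\<dots> \<le> 2 ^ (36 * j)" using 4 by (intro power_increasing) auto
        finally have "real ((k - 2) choose j) \<le> real (2 ^ (36 * j))" by (rule of_nat_mono)
        then show ?thesis by (simp add: power_mult)
      qed
      moreover have "b ^ e j \<le> (sqrt b ^ (k + 1)) ^ j"
      proof -
        have "j + 3 \<le> k + 1" using j by auto
        then have "j * (j + 3) \<le> (k + 1) * j" using mult_le_mono2[of "j + 3" "k + 1" j] by (simp only: mult.commute)
        have "b ^ e j = sqrt b ^ (j * (j + 3))"
          unfolding e2[symmetric] power_mult using b by simp
        also have "\<dots> \<le> sqrt b ^ ((k + 1) * j)"
          using b \<open>j * (j + 3) \<le> (k + 1) * j\<close> by (intro power_increasing) auto
        finally show ?thesis by (simp only: power_mult)
      qed
      ultimately have "real ((k - 2) choose j) * \<rho> ^ j * (b ^ e j - 1) \<le>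
          (2 ^ 36) ^ j * \<rho> ^ j * (sqrt b ^ (k + 1)) ^ j"
        using be rho by (intro mult_mono mult_right_mono) auto
      also have "\<dots> = (2 ^ 36 * \<rho> * sqrt b ^ (k + 1)) ^ j" by (simp only: power_mult_distrib)
      also have "\<dots> \<le> (exp (- 36) / 2) ^ j" using y rho b by (intro power_mono) auto
      also have "\<dots> = exp (- (36 * real j)) * (1 / 2) ^ j"
        by (simp add: power_divide mult.commute flip: exp_of_nat_mult)
      also have "\<dots> \<le> exp (- real k) * (1 / 2) ^ j" using 4 by simp
      also have "\<dots> \<le> (8 * x ^ 3 + exp (- real k)) * (1 / 2) ^ j"
        using xpos by (simp add: algebra_simps)
      finally have "real ((k - 2) choose j) * \<rho> ^ j * (b ^ e j - 1) \<le>
        (8 * x ^ 3 + exp (- real k)) * (1 / 2) ^ j" .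
      moreover have "(if j = 1 then A1 else 0) = 0" "(if j = 2 then A2 else 0) = 0" using 4 by auto
      ultimately show ?thesis by linarith
    qed
  qed
  have "overlap_sum k \<rho> b \<le> (\<Sum>j=1..k - 2. (if j = 1 then A1 else 0) + (if j = 2 then A2 else 0) +
      (8 * x ^ 3 + exp (- real k)) * (1 / 2) ^ j)"
    unfolding overlap_sum_def using term_le unfolding e_def by (intro sum_mono)
  also have "\<dots> = (\<Sum>j=1..k - 2. if j = 1 then A1 else 0) + (\<Sum>j=1..k - 2. if j = 2 then A2 else 0) +
      (8 * x ^ 3 + exp (- real k)) * (\<Sum>j=1..k - 2. (1 / 2) ^ j)"
    by (simp add: sum.distrib sum_distrib_left)
  also have "\<dots> \<le> A1 + A2 + (8 * x ^ 3 + exp (- real k)) * 1"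
    using A xpos sum_half_powers_le by (intro add_mono mult_left_mono) (auto simp: sum.delta)
  finally show ?thesis by (simp add: A1_def A2_def)
qed

text \<open>In order: a lower bound on log n; the four terms of \<open>overlap_sum_le\<close> times
  k^2; its two side conditions; the exponents of the cover and edge tails against 2 n; k \<le> m0;
  the shares of 2 D and of 2 in the colour budget. No condition mentions \<open>p\<close>.\<close>

definition sufficiently_large :: "real \<Rightarrow> real \<Rightarrow> real \<Rightarrow> nat \<Rightarrow> bool" where
  "sufficiently_large \<epsilon> \<delta> \<kappa> n \<longleftrightarrow>
     3 \<le> ln (real n) \<and>
     486 * ln (real n) ^ 6 * real n powr (- 3 * \<delta>) \<le> 1 / 4 \<and>
     23328 * ln (real n) ^ 10 * real n powr (- 6 * \<delta>) \<le> 1 / 4 \<and>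
     8 * (18 * ln (real n) ^ 4 * real n powr (- 5 / 18)) ^ 3 * (9 * ln (real n) ^ 2 * real n powr (2 / 3)) \<le> 1 / 4 \<and>
     9 * ln (real n) ^ 2 * real n powr (2 / 3) / real n \<le> 1 / 4 \<and>
     2 ^ 36 * 6 * ln (real n) ^ 3 * real n powr (- (2 / 3) * (1 - \<kappa>)) \<le> exp (- 36) / 2 \<and>
     18 * ln (real n) ^ 4 * real n powr (- 5 / 18) \<le> 1 / 2 \<and>
     2 * real n \<le> real n powr (1 + 3 * \<delta>) / (41472 * ln (real n) ^ 12) \<and>
     2 * real n \<le> (real n powr (2 / 3) / ln (real n) ^ 2) ^ 2 / 3 \<and>
     3 * ln (real n) * real n powr (1 / 3) \<le> real n / ln (real n) ^ 2 \<and>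
     4 / ln (real n) \<le> \<epsilon> / 4 \<and>
     2 \<le> \<epsilon> / 4 * (real n powr (2 / 3) / (2 * ln (real n)))"

lemma eventually_le_of_tendsto_0:
  fixes f :: "nat \<Rightarrow> real"
  shows "f \<longlonglongrightarrow> 0 \<Longrightarrow> 0 < c \<Longrightarrow> \<forall>\<^sub>F n in sequentially. f n \<le> c"
  using order_tendstoD(2)[of f 0 sequentially c] by (auto elim: eventually_mono)

lemma eventually_sufficiently_large:
  assumes "0 < \<epsilon>" "0 < \<delta>" "\<kappa> < 1"
  shows "\<forall>\<^sub>F n in sequentially. sufficiently_large \<epsilon> \<delta> \<kappa> n"
proof -
  define \<gamma> where "\<gamma> = (2 / 3) * (1 - \<kappa>)"
  have \<gamma>: "\<gamma> > 0" using assms by (simp add: \<gamma>_def)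
  have "\<forall>\<^sub>F n :: nat in sequentially. 3 \<le> ln (real n)" by real_asymp
  moreover have "\<forall>\<^sub>F n :: nat in sequentially. 486 * ln (real n) ^ 6 * real n powr (- 3 * \<delta>) \<le> 1 / 4"
    by (rule eventually_le_of_tendsto_0) (use assms in real_asymp, simp)
  moreover have "\<forall>\<^sub>F n :: nat in sequentially. 23328 * ln (real n) ^ 10 * real n powr (- 6 * \<delta>) \<le> 1 / 4"
    by (rule eventually_le_of_tendsto_0) (use assms in real_asymp, simp)
  moreover have "\<forall>\<^sub>F n :: nat in sequentially.
      8 * (18 * ln (real n) ^ 4 * real n powr (- 5 / 18)) ^ 3 * (9 * ln (real n) ^ 2 * real n powr (2 / 3)) \<le> 1 / 4"
    by (rule eventually_le_of_tendsto_0) (real_asymp, simp)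
  moreover have "\<forall>\<^sub>F n :: nat in sequentially. 9 * ln (real n) ^ 2 * real n powr (2 / 3) / real n \<le> 1 / 4"
    by real_asymp
  moreover have "\<forall>\<^sub>F n :: nat in sequentially.
      2 ^ 36 * 6 * ln (real n) ^ 3 * real n powr (- \<gamma>) \<le> exp (- 36) / 2"
    by (rule eventually_le_of_tendsto_0) (use \<gamma> in real_asymp, simp)
  moreover have "\<forall>\<^sub>F n :: nat in sequentially. 18 * ln (real n) ^ 4 * real n powr (- 5 / 18) \<le> 1 / 2"
    by real_asymp
  moreover have "\<forall>\<^sub>F n :: nat in sequentially.
      2 * real n \<le> real n powr (1 + 3 * \<delta>) / (41472 * ln (real n) ^ 12)"
    using assms by real_asymp
  moreover have "\<forall>\<^sub>F n :: nat in sequentially. 2 * real n \<le> (real n powr (2 / 3) / ln (real n) ^ 2) ^ 2 / 3"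
    by real_asymp
  moreover have "\<forall>\<^sub>F n :: nat in sequentially. 3 * ln (real n) * real n powr (1 / 3) \<le> real n / ln (real n) ^ 2"
    by real_asymp
  moreover have "\<forall>\<^sub>F n :: nat in sequentially. 4 / ln (real n) \<le> \<epsilon> / 4"
    by (rule eventually_le_of_tendsto_0) (real_asymp, use assms in simp)
  moreover have "\<forall>\<^sub>F n :: nat in sequentially. 2 \<le> \<epsilon> / 4 * (real n powr (2 / 3) / (2 * ln (real n)))"
    using assms by real_asymp
  ultimately show ?thesis
    unfolding sufficiently_large_def \<gamma>_def by eventually_elim simp
qed

text \<open>Everything at one fixed \<open>n\<close>. The reciprocal 1 + min \<epsilon> 1 / 4 of
  \<kappa> is the factor lost in n / k; the minimum keeps \<kappa> \<ge> 4 / 5.\<close>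

locale dense_parameters =
  fixes n :: nat and p b \<epsilon> \<delta> \<kappa> :: real
  assumes \<epsilon>_pos: "0 < \<epsilon>" and \<delta>_pos: "0 < \<delta>"
    and \<kappa>_def: "\<kappa> = 1 / (1 + min \<epsilon> 1 / 4)"
    and p_ge: "real n powr (- 1 / 3 + \<delta>) \<le> p" and p_le: "p \<le> 1 / 2"
    and b_def: "b = 1 / (1 - p)"
    and large: "sufficiently_large \<epsilon> \<delta> \<kappa> n"
begin

section \<open>Sizes of the parameters\<close>

definition "L = ln (real n)"
definition "lg = log b (real n * p)"
text \<open>Rounding up gives n / k \<le> n / (2 \<kappa> lg); the surplus vertex costs powers of b
  \<le> 2 at most.\<close>

definition "k = nat \<lceil>2 * \<kappa> * lg\<rceil>"

lemmas bounds = large[unfolded sufficiently_large_def, folded L_def]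

lemma L_ge: "3 \<le> L"
  using bounds by simp

lemma n_pos: "0 < real n"
  using L_ge unfolding L_def by (cases "n = 0") auto

lemma n_ge_1: "1 \<le> real n"
  using n_pos by simp

lemma exp_L: "exp L = real n"
  using n_pos by (simp add: L_def)

lemma powr_n_mono: "x \<le> y \<Longrightarrow> real n powr x \<le> real n powr y"
  using n_ge_1 by (intro powr_mono) auto

lemma p_ge': "real n powr (- 1 / 3) \<le> p"
  using powr_n_mono[of "- 1 / 3" "- 1 / 3 + \<delta>"] \<delta>_pos p_ge by linarith

lemma p_pos: "0 < p"
  using p_ge' n_pos by (smt (verit) powr_gt_zero)

text \<open>Here the margin \<delta> is exploited; elsewhere p \<ge> n^(-1/3) is enough. The
  quantity n p^3 governs the overlap terms j = 1, 2 and the cover tail.\<close>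

lemma p_cube: "real n powr (3 * \<delta>) \<le> real n * p ^ 3"
proof -
  have "real n powr (3 * \<delta>) = real n * (real n powr (- 1 / 3 + \<delta>)) ^ 3"
    using n_pos by (simp add: powr_mult_base powr_power algebra_simps)
  also have "\<dots> \<le> real n * p ^ 3"
    using p_ge n_pos by (intro mult_left_mono power_mono) auto
  finally show ?thesis .
qed

lemma inverse_p_le: "1 / p \<le> real n powr (1 / 3)"
proof -
  have "1 / p \<le> 1 / real n powr (- 1 / 3)"
    using p_ge' p_pos n_pos by (intro divide_left_mono) auto
  also have "\<dots> = real n powr (1 / 3)" by (simp add: powr_minus_divide)
  finally show ?thesis .
qed

lemma inverse_p_square_le: "1 / p\<^sup>2 \<le> real n powr (2 / 3)"
proof -
  have "1 / p\<^sup>2 = (1 / p)\<^sup>2" by (simp add: power_divide)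
  also have "\<dots> \<le> (real n powr (1 / 3))\<^sup>2" using inverse_p_le p_pos by (intro power_mono) auto
  also have "\<dots> = real n powr (2 / 3)" using n_pos by (simp add: powr_power)
  finally show ?thesis .
qed

lemma np_ge: "real n powr (2 / 3) \<le> real n * p"
proof -
  have "real n powr (2 / 3) = real n * real n powr (- 1 / 3)"
    using n_pos by (simp add: powr_mult_base)
  also have "\<dots> \<le> real n * p" using p_ge' n_pos by (intro mult_left_mono) auto
  finally show ?thesis .
qed

lemma np_pos: "0 < real n * p"
  using n_pos p_pos by simp

lemma ln_np: "2 / 3 * L \<le> ln (real n * p)" "ln (real n * p) \<le> L"
proof -
  have "2 / 3 * L = ln (real n powr (2 / 3))" using n_pos by (simp add: L_def ln_powr)
  also have "\<dots> \<le> ln (real n * p)" using np_ge n_pos np_pos by (subst ln_le_cancel_iff) auto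
  finally show "2 / 3 * L \<le> ln (real n * p)" .
  show "ln (real n * p) \<le> L"
    unfolding L_def using n_pos np_pos p_pos p_le by (subst ln_le_cancel_iff) auto
qed

lemma b_bounds: "1 < b" "b \<le> 2" "b - 1 \<le> 2 * p"
  using p_pos p_le by (auto simp: b_def field_simps mult_left_le)

lemma ln_b: "p \<le> ln b" "ln b \<le> 2 * p" "ln b \<le> 1" "0 < ln b"
proof -
  have "ln (1 - p) \<le> - p" using ln_le_minus_one[of "1 - p"] p_le p_pos by simp
  then show "p \<le> ln b" using p_le by (simp add: b_def ln_div)
  have "ln b \<le> b - 1" using b_bounds by (intro ln_le_minus_one) auto
  then show "ln b \<le> 2 * p" "ln b \<le> 1" using b_bounds by auto
  show "0 < ln b" using b_bounds by simp
qed

lemma lg_eq: "lg = ln (real n * p) / ln b"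
  by (simp add: lg_def log_def)

text \<open>ln b lies between p and 2 p, and ln (np) between 2 / 3 * L and L, so \<open>lg\<close>
  has order L / p.\<close>

lemma lg_bounds: "lg \<le> L / p" "2 / 3 * L \<le> lg" "L / 3 \<le> lg * p" "0 < lg"
proof -
  have L: "0 \<le> L" using L_ge by simp
  have "lg \<le> L / ln b" unfolding lg_eq using ln_np ln_b by (intro divide_right_mono) auto
  also have "\<dots> \<le> L / p" using ln_b p_pos L by (intro divide_left_mono) auto
  finally show "lg \<le> L / p" .
  have "2 / 3 * L \<le> 2 / 3 * L / ln b" using ln_b L by (simp add: le_divide_eq mult_left_le)
  also have le: "\<dots> \<le> lg" unfolding lg_eq using ln_np ln_b by (intro divide_right_mono) auto
  finally show "2 / 3 * L \<le> lg" .
  then show "0 < lg" using L_ge by simp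
  have "L / 3 = 2 / 3 * L / (2 * p) * p" using p_pos by simp
  also have "\<dots> \<le> 2 / 3 * L / ln b * p"
    using ln_b p_pos L by (intro mult_right_mono divide_left_mono) auto
  also have "\<dots> \<le> lg * p" using le p_pos by (intro mult_right_mono) auto
  finally show "L / 3 \<le> lg * p" .
qed

lemma \<kappa>_bounds: "4 / 5 \<le> \<kappa>" "\<kappa> < 1"
  using \<epsilon>_pos by (auto simp: \<kappa>_def field_simps min_def)

lemma k_bounds: "2 * \<kappa> * lg \<le> k" "k \<le> 2 * \<kappa> * lg + 1" "L \<le> k" "k \<le> 3 * L / p" "1 \<le> k * p"
proof -
  have pos: "0 \<le> 2 * \<kappa> * lg" using \<kappa>_bounds lg_bounds by simp
  show 1: "2 * \<kappa> * lg \<le> k" "k \<le> 2 * \<kappa> * lg + 1"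
    using pos by (auto simp: k_def)
  have "8 / 5 * lg \<le> 2 * \<kappa> * lg" using \<kappa>_bounds lg_bounds by (intro mult_right_mono) auto
  then have k8: "8 / 5 * lg \<le> k" using 1 by linarith
  then show "L \<le> k" using lg_bounds L_ge by linarith
  have "2 * \<kappa> * lg \<le> 2 * lg" using \<kappa>_bounds lg_bounds by simp
  moreover have "1 \<le> L / p" using L_ge p_pos p_le by (simp add: le_divide_eq)
  ultimately show "k \<le> 3 * L / p" using 1 lg_bounds(1) by simp
  have "8 / 5 * (lg * p) \<le> k * p" using mult_right_mono[OF k8, of p] p_pos by simp
  then show "1 \<le> k * p" using lg_bounds(3) L_ge by linarith
qed

lemma k_ge_2: "2 \<le> k"
  using k_bounds(3) L_ge by linarith

lemma b_powr_lg: "b powr (c * lg) = (real n * p) powr c"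
proof -
  have "b powr (c * lg) = (b powr lg) powr c" by (simp add: powr_powr mult.commute)
  also have "b powr lg = real n * p" using b_bounds np_pos by (simp add: lg_def)
  finally show ?thesis .
qed

lemma b_power_k: "b ^ k \<le> 2 * (real n)\<^sup>2"
proof -
  have "b ^ k = b powr k" using b_bounds by (simp add: powr_realpow)
  also have "\<dots> \<le> b powr (2 * \<kappa> * lg + 1)" using k_bounds b_bounds by (intro powr_mono) auto
  also have "\<dots> = (real n * p) powr (2 * \<kappa>) * b"
    using b_bounds by (simp add: powr_add b_powr_lg)
  also have "\<dots> \<le> (real n)\<^sup>2 * 2"
  proof (intro mult_mono)
    have "(real n * p) powr (2 * \<kappa>) \<le> real n powr (2 * \<kappa>)"
      using np_pos n_pos p_pos p_le \<kappa>_bounds by (intro powr_mono2) auto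
    also have "\<dots> \<le> real n powr 2" using \<kappa>_bounds by (intro powr_n_mono) auto
    finally show "(real n * p) powr (2 * \<kappa>) \<le> (real n)\<^sup>2" using n_pos by simp
  qed (use b_bounds in auto)
  finally show ?thesis by simp
qed

text \<open>The 36th root of b ^ k \<le> 2 n^2. Any exponent below 1 / 9 in place of 1 / 18 would
  make k^2 x^3 small in \<open>overlap_small\<close>.\<close>

lemma b_power_small:
  assumes "36 * j \<le> k"
  shows "b ^ j \<le> 2 * real n powr (1 / 18)"
proof -
  have "b ^ j = (b ^ (36 * j)) powr (1 / 36)"
    using b_bounds by (simp add: powr_powr flip: powr_realpow)
  also have "\<dots> \<le> (2 * (real n)\<^sup>2) powr (1 / 36)"
  proof (intro powr_mono2)
    have "b ^ (36 * j) \<le> b ^ k" using assms b_bounds by (intro power_increasing) auto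
    then show "b ^ (36 * j) \<le> 2 * (real n)\<^sup>2" using b_power_k by linarith
  qed (use b_bounds in auto)
  also have "\<dots> = 2 powr (1 / 36) * real n powr (1 / 18)"
  proof -
    have "((real n)\<^sup>2) powr (1 / 36) = (real n powr 2) powr (1 / 36)" using n_pos by simp
    also have "\<dots> = real n powr (1 / 18)" by (simp only: powr_powr) simp
    finally show ?thesis by (simp add: powr_mult)
  qed
  also have "\<dots> \<le> 2 powr 1 * real n powr (1 / 18)"
    by (intro mult_right_mono powr_mono) auto
  finally show ?thesis by simp
qed

text \<open>This is where \<open>k\<close> has to stay below 2 lg: \<rho> is at most 3 L^3 / (np),
  and only \<kappa> < 1 makes its product with (np)^\<kappa> tend to 0.\<close>

lemma sqrt_b_power: "sqrt b ^ (k + 1) \<le> 2 * (real n * p) powr \<kappa>"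
proof -
  have "sqrt b ^ (k + 1) = (b powr (1 / 2)) powr real (k + 1)"
    using b_bounds powr_realpow[of "sqrt b" "k + 1"] powr_half_sqrt[of b] by (simp only:) simp
  also have "\<dots> = b powr (real (k + 1) / 2)" by (simp add: powr_powr)
  also have "\<dots> \<le> b powr (\<kappa> * lg + 1)" using k_bounds b_bounds by (intro powr_mono) auto
  also have "\<dots> = (real n * p) powr \<kappa> * b"
    using b_bounds by (simp add: powr_add b_powr_lg)
  also have "\<dots> \<le> (real n * p) powr \<kappa> * 2" using b_bounds by (intro mult_left_mono) auto
  finally show ?thesis by simp
qed

text \<open>This is k / \<open>m0\<close>, the largest ratio k / card U allowed and, by
  \<open>overlap_sum_mono\<close>, the worst case.\<close>

definition "\<rho> = real k * L\<^sup>2 / real n"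

lemma k_square_le: "(real k)\<^sup>2 \<le> 9 * L\<^sup>2 / p\<^sup>2"
proof -
  have "(real k)\<^sup>2 \<le> (3 * L / p)\<^sup>2" using k_bounds by (intro power_mono) auto
  then show ?thesis by (simp add: power_divide power_mult_distrib)
qed

lemma k_square_le': "(real k)\<^sup>2 \<le> 9 * L\<^sup>2 * real n powr (2 / 3)"
proof -
  have "9 * L\<^sup>2 * (1 / p\<^sup>2) \<le> 9 * L\<^sup>2 * real n powr (2 / 3)"
    using inverse_p_square_le by (intro mult_left_mono) auto
  then show ?thesis using k_square_le by simp
qed

lemma k\<rho>_eq: "k * \<rho> = (real k)\<^sup>2 * L\<^sup>2 / real n"
  by (simp add: \<rho>_def power2_eq_square)

text \<open>Each of the four terms gets a quarter of the target. Up to logarithms, k is at most 1 /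
  p and k * \<rho> at most 1 / (n p^2), so k^2 times the four terms is at most 1 / (n p^3), its
  square, n^(-1/6) and n^(-1/3).\<close>

lemma overlap_small: "overlap_sum k \<rho> b \<le> 1 / (real k)\<^sup>2"
proof -
  define x where "x = 18 * L ^ 4 * real n powr (- 5 / 18)"
  have L0: "0 \<le> L" using L_ge by simp
  have \<rho>0: "0 \<le> \<rho>" using n_pos by (simp add: \<rho>_def)
  have k0: "0 < (real k)\<^sup>2" using k_ge_2 by simp
  have k\<rho>: "k * \<rho> \<le> 9 * L ^ 4 * real n powr (- 1 / 3)"
  proof -
    have "k * \<rho> \<le> 9 * L\<^sup>2 * real n powr (2 / 3) * L\<^sup>2 / real n"
      unfolding k\<rho>_eq using k_square_le' n_pos by (intro divide_right_mono mult_right_mono) auto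
    also have "\<dots> = 9 * L ^ 4 * (real n powr (2 / 3) / real n)" by (simp add: power2_eq_square power4_eq_xxxx)
    also have "real n powr (2 / 3) / real n = real n powr (- 1 / 3)"
      using powr_diff[of "real n" "2 / 3" 1] n_pos by simp
    finally show ?thesis .
  qed
  have "overlap_sum k \<rho> b \<le> k * \<rho> * (b\<^sup>2 - 1) + (k * \<rho>)\<^sup>2 * b ^ 5 + 8 * x ^ 3 + exp (- real k)"
  proof (rule overlap_sum_le[OF \<rho>0, where B = "2 * real n powr (1 / 18)"])
    have "k * \<rho> * (2 * real n powr (1 / 18)) \<le> 9 * L ^ 4 * real n powr (- 1 / 3) * (2 * real n powr (1 / 18))"
      using k\<rho> by (intro mult_right_mono) auto
    also have "\<dots> = 18 * L ^ 4 * (real n powr (- 1 / 3) * real n powr (1 / 18))" by simp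
    also have "real n powr (- 1 / 3) * real n powr (1 / 18) = real n powr (- 5 / 18)"
      by (simp flip: powr_add)
    finally show "k * \<rho> * (2 * real n powr (1 / 18)) \<le> x" by (simp add: x_def)
    show "x \<le> 1 / 2" using bounds by (simp add: x_def)
    show "2 ^ 36 * \<rho> * sqrt b ^ (k + 1) \<le> exp (- 36) / 2"
    proof -
      have "\<rho> \<le> (3 * L / p) * L\<^sup>2 / real n"
        unfolding \<rho>_def using k_bounds n_pos by (intro divide_right_mono mult_right_mono) auto
      also have "\<dots> = 3 * L ^ 3 / (real n * p)" by (simp add: power2_eq_square power3_eq_cube ac_simps)
      finally have "\<rho> * sqrt b ^ (k + 1) \<le> 3 * L ^ 3 / (real n * p) * (2 * (real n * p) powr \<kappa>)"
        using sqrt_b_power \<rho>0 b_bounds np_pos L0 by (intro mult_mono) auto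
      also have "\<dots> = 6 * L ^ 3 * ((real n * p) powr \<kappa> / (real n * p))" by simp
      also have "(real n * p) powr \<kappa> / (real n * p) = (real n * p) powr (\<kappa> - 1)"
        using np_pos by (simp add: powr_diff)
      also have "6 * L ^ 3 * (real n * p) powr (\<kappa> - 1) \<le> 6 * L ^ 3 * real n powr (- (2 / 3) * (1 - \<kappa>))"
      proof (intro mult_left_mono)
        have "(real n * p) powr (\<kappa> - 1) \<le> (real n powr (2 / 3)) powr (\<kappa> - 1)"
          using np_ge n_pos \<kappa>_bounds by (intro powr_mono2') auto
        also have "\<dots> = real n powr (- (2 / 3) * (1 - \<kappa>))"
          unfolding powr_powr by (rule arg_cong[where f = "\<lambda>x. real n powr x"]) (simp add: right_diff_distrib)
        finally show "(real n * p) powr (\<kappa> - 1) \<le> real n powr (- (2 / 3) * (1 - \<kappa>))" .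
      qed (use L0 in auto)
      finally have "2 ^ 36 * (\<rho> * sqrt b ^ (k + 1)) \<le>
          2 ^ 36 * (6 * L ^ 3 * real n powr (- (2 / 3) * (1 - \<kappa>)))"
        by (intro mult_left_mono) auto
      then show ?thesis using bounds by (simp only: mult.assoc) linarith
    qed
  qed (use b_bounds b_power_small in auto)
  also have "\<dots> \<le> 1 / (4 * (real k)\<^sup>2) + 1 / (4 * (real k)\<^sup>2) + 1 / (4 * (real k)\<^sup>2) + 1 / (4 * (real k)\<^sup>2)"
  proof (intro add_mono)
    have quarter: "z \<le> 1 / (4 * (real k)\<^sup>2)" if "(real k)\<^sup>2 * z \<le> 1 / 4" for z
      using that k0 by (simp add: field_simps)
    have k4: "(real k)\<^sup>2 * (k * \<rho>) \<le> 81 * L ^ 6 / (p ^ 4 * real n)"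
    proof -
      have "(real k)\<^sup>2 * (k * \<rho>) = ((real k)\<^sup>2)\<^sup>2 * L\<^sup>2 / real n"
        by (simp add: k\<rho>_eq power2_eq_square)
      also have "\<dots> \<le> (9 * L\<^sup>2 / p\<^sup>2)\<^sup>2 * L\<^sup>2 / real n"
        using k_square_le n_pos by (intro divide_right_mono mult_right_mono power_mono) auto
      also have "\<dots> = 81 * L ^ 6 / (p ^ 4 * real n)"
        by (simp add: power_divide power_mult_distrib flip: power_mult power_add)
      finally show ?thesis .
    qed
    have inv: "1 / (p ^ 3 * real n) \<le> real n powr (- 3 * \<delta>)"
    proof -
      have "1 / (p ^ 3 * real n) \<le> 1 / real n powr (3 * \<delta>)"
        using p_cube n_pos p_pos by (intro divide_left_mono) (auto simp: mult.commute)
      then show ?thesis by (simp add: powr_minus_divide)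
    qed
    show "k * \<rho> * (b\<^sup>2 - 1) \<le> 1 / (4 * (real k)\<^sup>2)"
    proof (rule quarter)
      have "b\<^sup>2 - 1 = (b - 1) * (b + 1)" by (simp add: power2_eq_square algebra_simps)
      also have "\<dots> \<le> (2 * p) * 3" using b_bounds p_pos by (intro mult_mono) auto
      finally have b6: "b\<^sup>2 - 1 \<le> 6 * p" by simp
      have "(real k)\<^sup>2 * (k * \<rho> * (b\<^sup>2 - 1)) = (real k)\<^sup>2 * (k * \<rho>) * (b\<^sup>2 - 1)" by simp
      also have "\<dots> \<le> 81 * L ^ 6 / (p ^ 4 * real n) * (6 * p)"
        using k4 b6 b_bounds p_pos n_pos L0 by (intro mult_mono) auto
      also have "\<dots> = 486 * L ^ 6 * (1 / (p ^ 3 * real n))"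
        using p_pos by (simp add: field_simps power_eq_if)
      also have "\<dots> \<le> 486 * L ^ 6 * real n powr (- 3 * \<delta>)"
        using inv L0 by (intro mult_left_mono) auto
      also have "\<dots> \<le> 1 / 4" using bounds by simp
      finally show "(real k)\<^sup>2 * (k * \<rho> * (b\<^sup>2 - 1)) \<le> 1 / 4" .
    qed
    show "(k * \<rho>)\<^sup>2 * b ^ 5 \<le> 1 / (4 * (real k)\<^sup>2)"
    proof (rule quarter)
      have b5: "b ^ 5 \<le> 2 ^ 5" using b_bounds by (intro power_mono) auto
      have "(real k)\<^sup>2 * ((k * \<rho>)\<^sup>2 * b ^ 5) = (real k)\<^sup>2 * (k * \<rho>) * (k * \<rho>) * b ^ 5"
        by (simp add: power2_eq_square)
      also have "\<dots> \<le> 81 * L ^ 6 / (p ^ 4 * real n) * (9 * L\<^sup>2 / p\<^sup>2 * L\<^sup>2 / real n) * 2 ^ 5"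
      proof (intro mult_mono)
        show "k * \<rho> \<le> 9 * L\<^sup>2 / p\<^sup>2 * L\<^sup>2 / real n"
          unfolding k\<rho>_eq using k_square_le n_pos by (intro divide_right_mono mult_right_mono) auto
      qed (use k4 b5 b_bounds \<rho>0 L0 p_pos n_pos in auto)
      also have "\<dots> = 23328 * L ^ 10 * (1 / (p ^ 3 * real n))\<^sup>2"
        using p_pos by (simp add: field_simps power_eq_if)
      also have "\<dots> \<le> 23328 * L ^ 10 * (real n powr (- 3 * \<delta>))\<^sup>2"
        using inv L0 n_pos p_pos by (intro mult_left_mono power_mono) auto
      also have "(real n powr (- 3 * \<delta>))\<^sup>2 = real n powr (- 6 * \<delta>)"
        using n_pos by (simp add: powr_power)
      also have "23328 * L ^ 10 * real n powr (- 6 * \<delta>) \<le> 1 / 4" using bounds by simp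
      finally show "(real k)\<^sup>2 * ((k * \<rho>)\<^sup>2 * b ^ 5) \<le> 1 / 4" .
    qed
    show "8 * x ^ 3 \<le> 1 / (4 * (real k)\<^sup>2)"
    proof (rule quarter)
      have "(real k)\<^sup>2 * (8 * x ^ 3) \<le> (9 * L\<^sup>2 * real n powr (2 / 3)) * (8 * x ^ 3)"
        using k_square_le' L0 by (intro mult_right_mono) (auto simp: x_def)
      also have "\<dots> = 8 * x ^ 3 * (9 * L\<^sup>2 * real n powr (2 / 3))" by (rule mult.commute)
      also have "\<dots> \<le> 1 / 4" using bounds unfolding x_def by blast
      finally show "(real k)\<^sup>2 * (8 * x ^ 3) \<le> 1 / 4" .
    qed
    show "exp (- real k) \<le> 1 / (4 * (real k)\<^sup>2)"
    proof (rule quarter)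
      have "exp (- real k) \<le> exp (- L)" using k_bounds by simp
      also have "\<dots> = 1 / real n" by (simp add: exp_minus exp_L inverse_eq_divide)
      finally have "(real k)\<^sup>2 * exp (- real k) \<le> (9 * L\<^sup>2 * real n powr (2 / 3)) * (1 / real n)"
        using k_square_le' by (intro mult_mono) auto
      also have "\<dots> \<le> 1 / 4" using bounds by simp
      finally show "(real k)\<^sup>2 * exp (- real k) \<le> 1 / 4" .
    qed
  qed
  also have "\<dots> = 1 / (real k)\<^sup>2" by simp
  finally show ?thesis .
qed

section \<open>Failure probabilities and the colour count\<close>

definition "m0 = real n / L\<^sup>2"
text \<open>Equal to p * \<open>m0\<close>, so D * card S is at least twice the expected number of
  edges inside a set of at most \<open>m0\<close> vertices.\<close>

definition "D = real n * p / L\<^sup>2"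

lemma m0_pos: "0 < m0" and D_pos: "0 < D"
  using n_pos p_pos L_ge by (auto simp: m0_def D_def)

lemma k_le_m0: "k \<le> m0"
proof -
  have "k \<le> 3 * L * (1 / p)" using k_bounds by simp
  also have "\<dots> \<le> 3 * L * real n powr (1 / 3)" using inverse_p_le L_ge by (intro mult_left_mono) auto
  also have "\<dots> \<le> m0" using bounds by (simp add: m0_def)
  finally show ?thesis .
qed

text \<open>The gap \<open>t\<close> is at least of order (np)^2 / L^6 and the variance proxy at
  most p n^2 / 2. The resulting exponent, of order n^2 p^3 / L^12, exceeds 2 n since n p^3 \<ge>
  n^(3 \<delta>). The factor \<open>p\<close> in the proxy is essential.\<close>

lemma cover_number_whp:
  assumes "U \<subseteq> {1..n}" "m0 \<le> card U"
  shows "subset_mean (nsets {1..n} 2) p (\<lambda>G. of_bool (cover_number G U k < (real (card U) / real k)\<^sup>2 / 8))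
    \<le> exp (- 2 * real n)"
proof -
  define t where "t = (real (card U) / real k)\<^sup>2 / 16"
  \<comment> \<open>The minimiser of - lam t + lam^2 p n^2 / 2; the exponent becomes - lam t /
    2.\<close>
  define lam where "lam = t / (p * (real n)\<^sup>2)"
  have k0: "0 < real k" using k_ge_2 by simp
  have U0: "0 < real (card U)" using assms m0_pos by linarith
  have Un: "real (card U) \<le> real n" using card_mono[OF _ assms(1)] by simp
  have t0: "0 \<le> t" by (simp add: t_def)
  have pn: "0 < p * (real n)\<^sup>2" using p_pos n_pos by simp
  have overlap: "overlap_sum k (real k / card U) (1 / (1 - p)) \<le> 1 / (real k)\<^sup>2"
  proof -
    have "real k / card U \<le> real k / m0" using assms m0_pos U0 by (intro divide_left_mono) auto
    also have "\<dots> = \<rho>" by (simp add: m0_def \<rho>_def)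
    finally have "overlap_sum k (real k / card U) b \<le> overlap_sum k \<rho> b"
      using b_bounds by (intro overlap_sum_mono) auto
    then show ?thesis using overlap_small by (simp add: b_def)
  qed
  have lam0: "0 \<le> lam" using t0 pn by (simp add: lam_def)
  have lam1: "lam \<le> 1"
  proof -
    have "t \<le> (real n / real k)\<^sup>2 / 16"
      unfolding t_def using Un k0 by (intro divide_right_mono power_mono) auto
    also have "\<dots> \<le> (real n / real k)\<^sup>2" by simp
    also have "\<dots> = (real n)\<^sup>2 / (real k)\<^sup>2" by (rule power_divide)
    also have "\<dots> \<le> p * (real n)\<^sup>2"
    proof -
      \<comment> \<open>lam \<le> 1 reduces to p k^2 \<ge> 1, which k p \<ge> 1 supplies.\<close>
      have "1 * 1 \<le> (real k * p) * real k" using k_bounds(5) k_ge_2 by (intro mult_mono) auto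
      then have "1 \<le> p * (real k)\<^sup>2" by (simp add: power2_eq_square algebra_simps)
      then have "(real n)\<^sup>2 * 1 \<le> (real n)\<^sup>2 * (p * (real k)\<^sup>2)" by (intro mult_left_mono) auto
      then show ?thesis using k0 by (simp add: divide_le_eq algebra_simps)
    qed
    finally show ?thesis using pn by (simp add: lam_def divide_le_eq)
  qed
  have "k \<le> card U" using k_le_m0 assms(2) by linarith
  then have "subset_mean (nsets {1..n} 2) p (\<lambda>G. of_bool (cover_number G U k < (real (card U) / real k)\<^sup>2 / 8))
      \<le> exp (- lam * t + lam\<^sup>2 * p * (card {1..n} choose 2))"
    unfolding t_def using assms p_pos p_le lam0 lam1 k_ge_2 overlap by (intro cover_number_tail) auto
  also have "\<dots> \<le> exp (- 2 * real n)"
  proof -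
    have "real (n choose 2) \<le> (real n)\<^sup>2 / 2"
      using choose_two[of n] by (cases n) (auto simp: real_of_nat_div field_simps power2_eq_square)
    then have "lam\<^sup>2 * p * (n choose 2) \<le> lam\<^sup>2 * p * ((real n)\<^sup>2 / 2)"
      using p_pos by (intro mult_left_mono) auto
    also have "\<dots> = lam * (lam * (p * (real n)\<^sup>2)) / 2" by (simp add: power2_eq_square)
    also have "lam * (p * (real n)\<^sup>2) = t" using p_pos n_pos by (simp add: lam_def)
    finally have "- lam * t + lam\<^sup>2 * p * (n choose 2) \<le> - (lam * t / 2)" by simp
    moreover have "2 * real n \<le> lam * t / 2"
    proof -
      have t_ge: "(real n)\<^sup>2 * p\<^sup>2 / (144 * L ^ 6) \<le> t"
      proof -
        have "m0 * p / (3 * L) \<le> real (card U) / real k"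
        proof -
          have "m0 * p / (3 * L) = m0 / (3 * L / p)" by simp
          also have "\<dots> \<le> real (card U) / real k"
            using assms(2) k_bounds(4) k0 m0_pos by (intro frac_le) auto
          finally show ?thesis .
        qed
        then have "(m0 * p / (3 * L))\<^sup>2 / 16 \<le> t"
          unfolding t_def using m0_pos p_pos L_ge by (intro divide_right_mono power_mono) auto
        moreover have "(m0 * p / (3 * L))\<^sup>2 / 16 = (real n)\<^sup>2 * p\<^sup>2 / (144 * L ^ 6)"
          by (simp add: m0_def power_divide power_mult_distrib flip: power_mult power_add)
        ultimately show ?thesis by simp
      qed
      \<comment> \<open>41472 = 2 * 144^2, where 144 combines the 16 in \<open>t\<close> with the
        square of 3 from k \<le> 3 L / p.\<close>
      have "2 * real n \<le> real n powr (1 + 3 * \<delta>) / (41472 * L ^ 12)" using bounds by simp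
      also have "\<dots> \<le> (real n)\<^sup>2 * p ^ 3 / (41472 * L ^ 12)"
      proof (intro divide_right_mono)
        have "real n powr (1 + 3 * \<delta>) = real n * real n powr (3 * \<delta>)"
          using n_pos by (simp add: powr_add)
        also have "\<dots> \<le> real n * (real n * p ^ 3)" using p_cube n_pos by (intro mult_left_mono) auto
        finally show "real n powr (1 + 3 * \<delta>) \<le> (real n)\<^sup>2 * p ^ 3" by (simp add: power2_eq_square)
      qed (use L_ge in auto)
      also have "\<dots> = ((real n)\<^sup>2 * p\<^sup>2 / (144 * L ^ 6))\<^sup>2 / (2 * (p * (real n)\<^sup>2))"
        using p_pos n_pos by (simp add: field_simps power_eq_if)
      also have "\<dots> \<le> t\<^sup>2 / (2 * (p * (real n)\<^sup>2))"
        using t_ge pn L_ge by (intro divide_right_mono power_mono) auto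
      also have "\<dots> = lam * t / 2" by (simp add: lam_def power2_eq_square)
      finally show ?thesis .
    qed
    ultimately show ?thesis by simp
  qed
  finally show ?thesis .
qed

text \<open>D is at least n^(2/3) / L^2, so D^2 outgrows n.\<close>

lemma edge_count_whp:
  assumes "S \<subseteq> {1..n}" "S \<noteq> {}" "card S \<le> m0"
  shows "subset_mean (nsets {1..n} 2) p (\<lambda>G. of_bool (D * card S \<le> card (G \<inter> nsets S 2)))
    \<le> exp (- 2 * real n)"
proof -
  have "p * card S \<le> p * m0" using assms p_pos by (intro mult_left_mono) auto
  then have "p * card S \<le> D" by (simp add: m0_def D_def mult.commute)
  then have "subset_mean (nsets {1..n} 2) p (\<lambda>G. of_bool (D * card S \<le> card (G \<inter> nsets S 2)))
      \<le> exp (- (D\<^sup>2 / 3))"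
    using assms p_pos p_le D_pos by (intro edge_count_tail) auto
  also have "\<dots> \<le> exp (- 2 * real n)"
  proof -
    have "2 * real n \<le> (real n powr (2 / 3) / L\<^sup>2)\<^sup>2 / 3" using bounds by simp
    also have "\<dots> \<le> D\<^sup>2 / 3"
      unfolding D_def using np_ge L_ge by (intro divide_right_mono power_mono) auto
    finally show ?thesis by simp
  qed
  finally show ?thesis .
qed

text \<open>In units of W = n / (2 lg): n / k takes 1 + \<epsilon> / 4, the terms 2 D and 2 take
  \<epsilon> / 4 each, \<Delta> takes \<epsilon> / 128 and the logarithmic term \<epsilon> /
  8.\<close>

lemma chromatic_bound:
  assumes H: "simple_graph {1..n} H"
    and \<Delta>: "real (max_degree {1..n} H) \<le> (1 / 2 ^ 8) * \<epsilon> * (real n / (lg * ln L))"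
  shows "2 * D + max_degree {1..n} H + 2 + n / real k + 8 * real (max_degree {1..n} H) * ln (n / m0)
    \<le> (1 + \<epsilon>) * (real n / (2 * lg))"
proof -
  define W where "W = real n / (2 * lg)"
  define d where "d = real (max_degree {1..n} H)"
  have W0: "0 < W" using n_pos lg_bounds by (simp add: W_def)
  have lnL: "1 \<le> ln L"
  proof -
    have "ln (exp 1) \<le> ln L" using exp_le L_ge by (subst ln_le_cancel_iff) auto
    then show ?thesis by simp
  qed
  have d_lnL: "d * ln L \<le> \<epsilon> * W / 128"
  proof -
    have "d * ln L \<le> (1 / 2 ^ 8) * \<epsilon> * (real n / (lg * ln L)) * ln L"
      unfolding d_def using \<Delta> lnL by (intro mult_right_mono) auto
    also have "\<dots> = \<epsilon> * W / 128" using lnL by (simp add: W_def)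
    finally show ?thesis .
  qed
  have "d * 1 \<le> d * ln L" using lnL by (intro mult_left_mono) (auto simp: d_def)
  then have d_le: "d \<le> \<epsilon> * W / 128" using d_lnL by linarith
  \<comment> \<open>The source of the iterated logarithm: n / \<open>m0\<close> is L^2.\<close>
  have "ln (n / m0) = 2 * ln L" using n_pos L_ge by (simp add: m0_def ln_realpow)
  then have ln_le: "8 * d * ln (n / m0) \<le> \<epsilon> * W / 8" using d_lnL by simp
  have "n / real k \<le> n / (2 * \<kappa> * lg)"
    using k_bounds(1) k_ge_2 \<kappa>_bounds lg_bounds n_pos by (intro divide_left_mono) (auto intro!: mult_pos_pos)
  also have "\<dots> = (1 + min \<epsilon> 1 / 4) * W"
    by (simp add: W_def \<kappa>_def)
  also have "\<dots> \<le> (1 + \<epsilon> / 4) * W" using W0 by (intro mult_right_mono) auto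
  finally have nk: "n / real k \<le> (1 + \<epsilon> / 4) * W" .
  have W_ge: "real n * p / (2 * L) \<le> W"
  proof -
    have "real n * p / (2 * L) = real n / (2 * (L / p))" by simp
    also have "\<dots> \<le> W" unfolding W_def using lg_bounds n_pos p_pos L_ge by (intro divide_left_mono) auto
    finally show ?thesis .
  qed
  have "2 * D = 4 / L * (real n * p / (2 * L))" by (simp add: D_def power2_eq_square)
  also have "\<dots> \<le> \<epsilon> / 4 * W"
    using bounds W_ge np_pos L_ge \<epsilon>_pos by (intro mult_mono) auto
  finally have D_le: "2 * D \<le> \<epsilon> / 4 * W" .
  have "2 \<le> \<epsilon> / 4 * (real n powr (2 / 3) / (2 * L))" using bounds by simp
  also have "\<dots> \<le> \<epsilon> / 4 * (real n * p / (2 * L))"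
    using np_ge L_ge \<epsilon>_pos by (intro mult_left_mono divide_right_mono) auto
  also have "\<dots> \<le> \<epsilon> / 4 * W" using W_ge \<epsilon>_pos by (intro mult_left_mono) auto
  finally have two_le: "2 \<le> \<epsilon> / 4 * W" .
  have "0 \<le> \<epsilon> * W" using \<epsilon>_pos W0 by simp
  have "2 * D + d + 2 + n / real k + 8 * d * ln (n / m0) \<le> (1 + \<epsilon>) * W"
    using D_le d_le two_le nk ln_le \<open>0 \<le> \<epsilon> * W\<close> by (simp add: algebra_simps)
  then show ?thesis by (simp add: W_def d_def)
qed

text \<open>A union bound over the 2^n vertex sets, with two bad events for each. \<open>H\<close>
  is quantified inside the event and does not enter the union bound.\<close>

lemma prob_ge:
  "1 - 2 ^ n * (2 * exp (- 2 * real n)) \<le> measure_pmf.prob (Gnp n p)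
    {G. \<forall>H. simple_graph {1..n} H \<and>
      real (max_degree {1..n} H) \<le> (1 / 2 ^ 8) * \<epsilon> * (real n / (log b (real n * p) * ln (ln (real n)))) \<longrightarrow>
      real (chromatic_number {1..n} (G \<union> H)) \<le> (1 + \<epsilon>) * (real n / (2 * log b (real n * p)))}"
proof -
  \<comment> \<open>Size restrictions are premises of \<open>X\<close> and \<open>Y\<close>, so one
    union bound can run over all of \<open>Pow {1..n}\<close>.\<close>
  define X where "X U G \<longleftrightarrow> m0 \<le> card U \<longrightarrow> (real (card U) / real k)\<^sup>2 / 8 \<le> cover_number G U k"
    for U :: "nat set" and G
  define Y where "Y S G \<longleftrightarrow> S \<noteq> {} \<and> card S \<le> m0 \<longrightarrow> card (G \<inter> nsets S 2) < D * card S"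
    for S :: "nat set" and G
  let ?m = "subset_mean (nsets {1..n} 2) p"
  have fE: "finite (nsets {1..n} 2)" by (simp add: finite_imp_finite_nsets)
  have "1 - card (Pow {1..n}) * (2 * exp (- 2 * real n)) \<le>
    ?m (\<lambda>G. of_bool (\<forall>H. simple_graph {1..n} H \<and>
      real (max_degree {1..n} H) \<le> (1 / 2 ^ 8) * \<epsilon> * (real n / (lg * ln L)) \<longrightarrow>
      real (chromatic_number {1..n} (G \<union> H)) \<le> (1 + \<epsilon>) * (real n / (2 * lg))))"
  proof (rule subset_mean_union_bound[where P = "\<lambda>U G. X U G \<and> Y U G", OF fE])
    fix U assume "U \<in> Pow {1..n}"
    then have U: "U \<subseteq> {1..n}" by simp
    have "?m (\<lambda>G. of_bool (\<not> (X U G \<and> Y U G))) \<le> ?m (\<lambda>G. of_bool (\<not> X U G) + of_bool (\<not> Y U G))"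
      using p_pos p_le by (intro subset_mean_mono) auto
    also have "\<dots> = ?m (\<lambda>G. of_bool (\<not> X U G)) + ?m (\<lambda>G. of_bool (\<not> Y U G))"
      by (rule subset_mean_add)
    also have "\<dots> \<le> exp (- 2 * real n) + exp (- 2 * real n)"
    proof (intro add_mono)
      show "?m (\<lambda>G. of_bool (\<not> X U G)) \<le> exp (- 2 * real n)"
        using cover_number_whp[OF U] fE by (cases "m0 \<le> card U") (auto simp: X_def not_le)
      show "?m (\<lambda>G. of_bool (\<not> Y U G)) \<le> exp (- 2 * real n)"
        using edge_count_whp[OF U] fE by (cases "U \<noteq> {} \<and> card U \<le> m0") (auto simp: Y_def not_less)
    qed
    finally show "?m (\<lambda>G. of_bool (\<not> (X U G \<and> Y U G))) \<le> 2 * exp (- 2 * real n)" by simp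
  next
    fix G assume G: "G \<subseteq> nsets {1..n} 2" and XY: "\<And>U. U \<in> Pow {1..n} \<Longrightarrow> X U G \<and> Y U G"
    have "m0 \<le> n"
    proof -
      have "1 \<le> L\<^sup>2" using L_ge by (simp add: one_le_power)
      then show ?thesis using n_pos by (simp add: m0_def divide_le_eq mult_left_le)
    qed
    then have chi: "real (chromatic_number {1..n} (G \<union> H)) \<le> 2 * D + max_degree {1..n} H + 2 +
        n / real k + 8 * real (max_degree {1..n} H) * ln (n / m0)" if "simple_graph {1..n} H" for H
      using chromatic_number_Un_le[OF _ G that k_ge_2 m0_pos] XY D_pos
      by (simp add: X_def Y_def)
    show "\<forall>H. simple_graph {1..n} H \<and>
      real (max_degree {1..n} H) \<le> (1 / 2 ^ 8) * \<epsilon> * (real n / (lg * ln L)) \<longrightarrow>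
      real (chromatic_number {1..n} (G \<union> H)) \<le> (1 + \<epsilon>) * (real n / (2 * lg))"
      using order_trans[OF chi chromatic_bound] by blast
  qed (use p_pos p_le in auto)
  then show ?thesis
    unfolding lg_def L_def using p_pos p_le by (subst prob_Gnp) (auto simp: card_Pow)
qed

end

theorem theorem1p2:
  fixes \<epsilon> \<delta> :: real and p b :: "nat \<Rightarrow> real"
  assumes eps: "\<epsilon> > 0"
    and delta: "\<delta> > 0"
    and p: "\<forall>\<^sub>F n in sequentially. real n powr (- 1 / 3 + \<delta>) \<le> p n \<and> p n \<le> 1 / 2"
    and b: "\<And>n. b n = 1 / (1 - p n)"
  shows "(\<lambda>n. measure_pmf.prob (Gnp n (p n))
            {G. \<forall>H. simple_graph {1..n} H \<and>
                    real (max_degree {1..n} H)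
                      \<le> (1 / 2 ^ 8) * \<epsilon> * (real n / (log (b n) (real n * p n) * ln (ln (real n)))) \<longrightarrow>
                    real (chromatic_number {1..n} (G \<union> H))
                      \<le> (1 + \<epsilon>) * (real n / (2 * log (b n) (real n * p n)))})
         \<longlonglongrightarrow> 1"
proof (rule tendsto_sandwich)
  define \<kappa> where "\<kappa> = 1 / (1 + min \<epsilon> 1 / 4)"
  have "\<kappa> < 1" using eps by (auto simp: \<kappa>_def field_simps min_def)
  \<comment> \<open>Every \<open>n\<close> satisfying both eventual conditions gives an instance of
    the locale.\<close>
  from eventually_conj[OF p eventually_sufficiently_large[OF eps delta this]]
  show "\<forall>\<^sub>F n in sequentially. 1 - 2 ^ n * (2 * exp (- 2 * real n)) \<le> measure_pmf.prob (Gnp n (p n))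
            {G. \<forall>H. simple_graph {1..n} H \<and>
                    real (max_degree {1..n} H)
                      \<le> (1 / 2 ^ 8) * \<epsilon> * (real n / (log (b n) (real n * p n) * ln (ln (real n)))) \<longrightarrow>
                    real (chromatic_number {1..n} (G \<union> H))
                      \<le> (1 + \<epsilon>) * (real n / (2 * log (b n) (real n * p n)))}"
  proof eventually_elim
    case (elim n)
    then interpret dense_parameters n "p n" "b n" \<epsilon> \<delta> \<kappa>
      using eps delta b by unfold_locales (auto simp: \<kappa>_def)
    show ?case by (rule prob_ge)
  qed
  \<comment> \<open>The error is 2 (2 / e^2)^n.\<close>
  show "(\<lambda>n :: nat. 1 - 2 ^ n * (2 * exp (- 2 * real n)) :: real) \<longlonglongrightarrow> 1" by real_asymp
  show "(\<lambda>_. 1 :: real) \<longlonglongrightarrow> 1" by simp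
qed (simp add: measure_pmf.prob_le_1)

end
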